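(* Let $X$ be a Hausdorff, path-connected, locally path-connected and semilocally simply connected space, and assume $X$ is braid-free. Then: (1) For every Weierstrass polynomial $f$ on $X$, the splitting covering $E_f\to X$ is isomorphic to the identity covering of $X$. (2) Hence $\Pi^{\mathrm{ST}}(X,x)=1$ for every basepoint $x\in X$. (3) Consequently, for every discrete $\Pi^{\mathrm{ST}}(X)$-module $A$ and every $n>0$, $H^n_{\mathrm{ST}}(X,A)=H^n_{\mathrm{cont}}(\Pi^{\mathrm{ST}}(X),A)=0$.
   Context: A group $\Gamma$ is braid-free if for every $n\ge1$ every homomorphism from $\Gamma$ to the Artin braid group $B_n$ is trivial. A space $X$ is braid-free if $\pi_1(X)$ is braid-free. $C(X)$ is the ring of continuous functions $X\to\mathbb{C}$. A Weierstrass polynomial of degree $n$ on $X$ is a monic $f(z)=z^n+a_{n-1}z^{n-1}+\cdots+a_0\in C(X)[z]$ such that for each $x\in X$ the specialization $f_x(z)\in\mathbb{C}[z]$ has $n$ distinct complex roots. For a path-connected covering $p:Y\to X$, $f$ splits in $Y$ if $p^*f\in C(Y)[z]$ (coefficients composed with $p$) has $n$ distinct roots in $C(Y)$. A splitting covering of $f$ is a path-connected covering $q:E_f\to X$ in which $f$ splits and which is minimal: whenever $f$ splits in a covering $p:Y\to X$, there is a covering map $Y\to E_f$ over $X$. Known: a splitting covering exists, is unique up to isomorphism over $X$, and is finite and Galois (regular). $\mathrm{Deck}(Y/X)$ denotes the group of homeomorphisms of $Y$ over $X$. $E_f$ dominates $E_g$ if there is a covering map $E_f\to E_g$ over $X$.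 Fix $x\in X$ and a point $e_f\in E_f$ over $x$ for each $f$; if $E_f$ dominates $E_g$ there is a unique covering map $\phi:E_f\to E_g$ over $X$ with $\phi(e_f)=e_g$, and a homomorphism $\mathrm{res}:\mathrm{Deck}(E_f/X)\to\mathrm{Deck}(E_g/X)$ determined by $\mathrm{res}(\sigma)\circ\phi=\phi\circ\sigma$. The absolute semi-topological Galois group is the profinite group $\Pi^{\mathrm{ST}}(X)=\Pi^{\mathrm{ST}}(X,x):=\varprojlim_f\mathrm{Deck}(E_f/X)$, over all Weierstrass polynomials $f$ on $X$ with these transition maps. For a profinite group $G$, a discrete $G$-module is an abelian group with $G$-action such that all stabilizers are open; $H^n_{\mathrm{cont}}(G,A)$ is the cohomology of the inhomogeneous complex of continuous functions $G^n\to A$. $H^n_{\mathrm{ST}}(X,A):=H^n_{\mathrm{cont}}(\Pi^{\mathrm{ST}}(X),A)$. *)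

theory Defs
  imports
    "HOL-Analysis.Analysis"
    "HOL-Algebra.Product_Groups"
    "HOL-Algebra.Group_Action"
    "HOL-Algebra.Ring"
begin

section \<open>Artin braid groups and braid-free groups\<close>

text \<open>
  The group \<open>B_n\<close> is given by Artin's presentation.  The letter \<open>(i, True)\<close> stands for the
  generator \<open>\<sigma>_i\<close> and \<open>(i, False)\<close> for its inverse, where \<open>1 \<le> i \<le> n - 1\<close>.
\<close>

definition braid_words :: "nat \<Rightarrow> (nat \<times> bool) list set" where
  "braid_words n = lists ({1..<n} \<times> UNIV)"

inductive braid_eq :: "nat \<Rightarrow> (nat \<times> bool) list \<Rightarrow> (nat \<times> bool) list \<Rightarrow> bool" for n where
  refl: "u \<in> braid_words n \<Longrightarrow> braid_eq n u u"
| sym: "braid_eq n u v \<Longrightarrow> braid_eq n v u"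
| trans: "braid_eq n u v \<Longrightarrow> braid_eq n v w \<Longrightarrow> braid_eq n u w"
| congr: "braid_eq n u v \<Longrightarrow> a \<in> braid_words n \<Longrightarrow> b \<in> braid_words n
    \<Longrightarrow> braid_eq n (a @ u @ b) (a @ v @ b)"
| cancel: "i \<in> {1..<n} \<Longrightarrow> braid_eq n [(i, s), (i, \<not> s)] []"
| far_commute: "1 \<le> i \<Longrightarrow> i + 2 \<le> j \<Longrightarrow> j < n
    \<Longrightarrow> braid_eq n [(i, True), (j, True)] [(j, True), (i, True)]"
| braid: "1 \<le> i \<Longrightarrow> i + 1 < n
    \<Longrightarrow> braid_eq n [(i, True), (i + 1, True), (i, True)] [(i + 1, True), (i, True), (i + 1, True)]"

definition braid_rel :: "nat \<Rightarrow> ((nat \<times> bool) list \<times> (nat \<times> bool) list) set" where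
  "braid_rel n = {(u, v). braid_eq n u v}"

definition braid_group :: "nat \<Rightarrow> (nat \<times> bool) list set monoid" where
  "braid_group n =
    \<lparr>carrier = braid_words n // braid_rel n,
     mult = (\<lambda>U V. \<Union>u\<in>U. \<Union>v\<in>V. braid_rel n `` {u @ v}),
     one = braid_rel n `` {[]}\<rparr>"

definition braid_free :: "('g, 'z) monoid_scheme \<Rightarrow> bool" where
  "braid_free \<Gamma> \<longleftrightarrow>
    (\<forall>n\<ge>1. \<forall>h\<in>hom \<Gamma> (braid_group n). \<forall>g\<in>carrier \<Gamma>. h g = \<one>\<^bsub>braid_group n\<^esub>)"


lemma braid_eq_words: "braid_eq n u v \<Longrightarrow> u \<in> braid_words n \<and> v \<in> braid_words n"
  by (induction rule: braid_eq.induct) (auto simp: braid_words_def)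

lemma equiv_braid_rel: "equiv (braid_words n) (braid_rel n)"
  by (auto intro!: equivI refl_onI symI transI simp: braid_rel_def
      intro: braid_eq.refl braid_eq.sym braid_eq.trans dest: braid_eq_words)

lemma braid_eq_append:
  assumes "braid_eq n u u'" "braid_eq n v v'"
  shows "braid_eq n (u @ v) (u' @ v')"
proof -
  have "braid_eq n ([] @ u @ v) ([] @ u' @ v)" "braid_eq n (u' @ v @ []) (u' @ v' @ [])"
    using assms by (auto intro!: braid_eq.congr dest: braid_eq_words simp: braid_words_def
        simp del: append_Nil append_Nil2)
  then show ?thesis
    by (auto intro: braid_eq.trans)
qed

lemma braid_mult_class:
  assumes "u \<in> braid_words n" "v \<in> braid_words n"
  shows "braid_rel n `` {u} \<otimes>\<^bsub>braid_group n\<^esub> braid_rel n `` {v} = braid_rel n `` {u @ v}"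
proof -
  have "congruent2 (braid_rel n) (braid_rel n) (\<lambda>u v. braid_rel n `` {u @ v})"
    by (rule congruent2I[OF equiv_braid_rel equiv_braid_rel];
        intro equiv_class_eq[OF equiv_braid_rel])
      (auto simp: braid_rel_def intro: braid_eq_append braid_eq.refl)
  then show ?thesis
    using UN_equiv_class2[OF equiv_braid_rel equiv_braid_rel _ assms]
    by (simp add: braid_group_def)
qed

lemma braid_word_inverse:
  assumes "u \<in> braid_words n"
  shows "\<exists>v\<in>braid_words n. braid_eq n (v @ u) []"
  using assms
proof (induction u)
  case Nil
  show ?case by (rule bexI[of _ "[]"]) (auto simp: braid_words_def intro: braid_eq.refl)
next
  case (Cons a u)
  obtain i s where a: "a = (i, s)" by (cases a)
  have i: "i \<in> {1..<n}" and u: "u \<in> braid_words n" using Cons.prems a by (auto simp: braid_words_def)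
  then obtain v where v: "v \<in> braid_words n" "braid_eq n (v @ u) []" using Cons.IH by auto
  have "braid_eq n (v @ [(i, \<not> s), (i, \<not> \<not> s)] @ u) (v @ [] @ u)"
    using v u i by (intro braid_eq.congr braid_eq.cancel) auto
  then have "braid_eq n ((v @ [(i, \<not> s)]) @ a # u) []"
    using v a by (auto intro: braid_eq.trans)
  moreover have "v @ [(i, \<not> s)] \<in> braid_words n" using v i by (auto simp: braid_words_def)
  ultimately show ?case by blast
qed

lemma group_braid_group: "group (braid_group n)"
proof (rule groupI)
  have cl: "\<exists>u\<in>braid_words n. U = braid_rel n `` {u}" if "U \<in> carrier (braid_group n)" for U
    using that by (auto simp: braid_group_def quotient_def)
  have in_cl: "braid_rel n `` {u} \<in> carrier (braid_group n)" if "u \<in> braid_words n" for u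
    using that by (auto simp: braid_group_def quotient_def)
  have nil: "[] \<in> braid_words n" and
    app: "u \<in> braid_words n \<Longrightarrow> v \<in> braid_words n \<Longrightarrow> u @ v \<in> braid_words n" for u v
    by (auto simp: braid_words_def)
  have one: "\<one>\<^bsub>braid_group n\<^esub> = braid_rel n `` {[]}" by (simp add: braid_group_def)
  show "\<one>\<^bsub>braid_group n\<^esub> \<in> carrier (braid_group n)"
    unfolding one by (rule in_cl[OF nil])
  fix x assume "x \<in> carrier (braid_group n)"
  then obtain u where u: "u \<in> braid_words n" "x = braid_rel n `` {u}" using cl by blast
  show "\<one>\<^bsub>braid_group n\<^esub> \<otimes>\<^bsub>braid_group n\<^esub> x = x"
    using u nil by (simp add: one braid_mult_class)
  obtain v where v: "v \<in> braid_words n" "braid_eq n (v @ u) []"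
    using braid_word_inverse u by blast
  then have "braid_rel n `` {v @ u} = braid_rel n `` {[]}"
    by (intro equiv_class_eq[OF equiv_braid_rel]) (auto simp: braid_rel_def)
  then show "\<exists>y\<in>carrier (braid_group n). y \<otimes>\<^bsub>braid_group n\<^esub> x = \<one>\<^bsub>braid_group n\<^esub>"
    using u v by (intro bexI[OF _ in_cl[of v]]) (auto simp: one braid_mult_class)
  fix y assume "y \<in> carrier (braid_group n)"
  then obtain v where v: "v \<in> braid_words n" "y = braid_rel n `` {v}" using cl by blast
  show "x \<otimes>\<^bsub>braid_group n\<^esub> y \<in> carrier (braid_group n)"
    using u v app in_cl by (simp add: braid_mult_class)
  fix z assume "z \<in> carrier (braid_group n)"
  then obtain w where w: "w \<in> braid_words n" "z = braid_rel n `` {w}" using cl by blast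
  show "x \<otimes>\<^bsub>braid_group n\<^esub> y \<otimes>\<^bsub>braid_group n\<^esub> z = x \<otimes>\<^bsub>braid_group n\<^esub> (y \<otimes>\<^bsub>braid_group n\<^esub> z)"
    using u v w app by (simp add: braid_mult_class)
qed


section \<open>The fundamental group of an abstract topological space\<close>

text \<open>
  As for the library's \<^const>\<open>pathin\<close>, only the values of a path on the unit interval matter; two
  loops agreeing there are homotopic, so the values elsewhere disappear in the quotient.
\<close>

definition loops_at :: "'a topology \<Rightarrow> 'a \<Rightarrow> (real \<Rightarrow> 'a) set" where
  "loops_at X x = {\<gamma>. pathin X \<gamma> \<and> \<gamma> 0 = x \<and> \<gamma> 1 = x}"

definition loop_rel :: "'a topology \<Rightarrow> 'a \<Rightarrow> ((real \<Rightarrow> 'a) \<times> (real \<Rightarrow> 'a)) set" where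
  "loop_rel X x =
    {(\<gamma>, \<delta>). homotopic_with (\<lambda>r. r 0 = x \<and> r 1 = x) (top_of_set {0..1}) X \<gamma> \<delta>}"

lemma equiv_loop_rel: "equiv (loops_at X x) (loop_rel X x)"
  unfolding loop_rel_def loops_at_def pathin_def
  by (intro equivI refl_onI symI transI)
     (auto dest: homotopic_with_imp_continuous_maps homotopic_with_imp_property homotopic_with_symD
       intro: homotopic_with_trans)

definition path_concat :: "(real \<Rightarrow> 'a) \<Rightarrow> (real \<Rightarrow> 'a) \<Rightarrow> real \<Rightarrow> 'a" where
  "path_concat \<gamma> \<delta> = (\<lambda>t. if t \<le> 1/2 then \<gamma> (2 * t) else \<delta> (2 * t - 1))"

definition fundamental_group :: "'a topology \<Rightarrow> 'a \<Rightarrow> (real \<Rightarrow> 'a) set monoid" where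
  "fundamental_group X x =
    \<lparr>carrier = loops_at X x // loop_rel X x,
     mult = (\<lambda>A B. \<Union>\<gamma>\<in>A. \<Union>\<delta>\<in>B. loop_rel X x `` {path_concat \<gamma> \<delta>}),
     one = loop_rel X x `` {\<lambda>_. x}\<rparr>"

definition braid_free_space :: "'a topology \<Rightarrow> bool" where
  "braid_free_space X \<longleftrightarrow> (\<forall>x\<in>topspace X. braid_free (fundamental_group X x))"

definition semilocally_simply_connected_space :: "'a topology \<Rightarrow> bool" where
  "semilocally_simply_connected_space X \<longleftrightarrow>
    (\<forall>x\<in>topspace X. \<exists>U. openin X U \<and> x \<in> U \<and>
      (\<forall>\<gamma>\<in>loops_at X x. \<gamma> ` {0..1} \<subseteq> U \<longrightarrow> (\<gamma>, \<lambda>_. x) \<in> loop_rel X x))"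


section \<open>Coverings\<close>

text \<open>The analogue of the library's \<^const>\<open>covering_space\<close> for abstract topologies.\<close>

definition covering_map :: "'b topology \<Rightarrow> 'a topology \<Rightarrow> ('b \<Rightarrow> 'a) \<Rightarrow> bool" where
  "covering_map Y X p \<longleftrightarrow>
    continuous_map Y X p \<and> p ` topspace Y = topspace X \<and>
    (\<forall>x\<in>topspace X. \<exists>U. openin X U \<and> x \<in> U \<and>
      (\<exists>\<V>. \<Union>\<V> = {y \<in> topspace Y. p y \<in> U} \<and>
        (\<forall>V\<in>\<V>. openin Y V) \<and> pairwise disjnt \<V> \<and>
        (\<forall>V\<in>\<V>. homeomorphic_map (subtopology Y V) (subtopology X U) p)))"

definition covering_map_over ::
  "'b topology \<Rightarrow> ('b \<Rightarrow> 'a) \<Rightarrow> 'c topology \<Rightarrow> ('c \<Rightarrow> 'a) \<Rightarrow> ('b \<Rightarrow> 'c) \<Rightarrow> bool" where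
  "covering_map_over Y p E q \<phi> \<longleftrightarrow> covering_map Y E \<phi> \<and> (\<forall>y\<in>topspace Y. q (\<phi> y) = p y)"

definition isomorphic_over ::
  "'b topology \<Rightarrow> ('b \<Rightarrow> 'a) \<Rightarrow> 'c topology \<Rightarrow> ('c \<Rightarrow> 'a) \<Rightarrow> bool" where
  "isomorphic_over Y p E q \<longleftrightarrow>
    (\<exists>\<phi>. homeomorphic_map Y E \<phi> \<and> (\<forall>y\<in>topspace Y. q (\<phi> y) = p y))"

definition Deck :: "'b topology \<Rightarrow> ('b \<Rightarrow> 'a) \<Rightarrow> ('b \<Rightarrow> 'b) monoid" where
  "Deck Y p = BijGroup (topspace Y)
    \<lparr>carrier := {\<sigma> \<in> Bij (topspace Y). homeomorphic_map Y Y \<sigma> \<and> (\<forall>y\<in>topspace Y. p (\<sigma> y) = p y)}\<rparr>"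


section \<open>Weierstrass polynomials and splitting coverings\<close>

text \<open>Elements of \<open>C(X)\<close> are made unique by fixing their values off the carrier of \<open>X\<close>.\<close>

definition cfunctions :: "'a topology \<Rightarrow> ('a \<Rightarrow> complex) set" where
  "cfunctions X = {r \<in> extensional (topspace X). continuous_map X euclidean r}"

text \<open>
  A polynomial over \<open>C(X)\<close> is encoded as the family \<open>x \<mapsto> f_x\<close> of its specializations; its
  coefficients are the functions \<open>x \<mapsto> coeff (f x) i\<close>.
\<close>

definition weierstrass_polynomial :: "'a topology \<Rightarrow> nat \<Rightarrow> ('a \<Rightarrow> complex poly) \<Rightarrow> bool" where
  "weierstrass_polynomial X n f \<longleftrightarrow>
    1 \<le> n \<and> f \<in> extensional (topspace X) \<and>
    (\<forall>i. continuous_map X euclidean (\<lambda>x. coeff (f x) i)) \<and>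
    (\<forall>x\<in>topspace X. degree (f x) = n \<and> lead_coeff (f x) = 1 \<and>
      card {z. poly (f x) z = 0} = n)"

definition splits_in ::
  "'b topology \<Rightarrow> ('b \<Rightarrow> 'a) \<Rightarrow> nat \<Rightarrow> ('a \<Rightarrow> complex poly) \<Rightarrow> bool" where
  "splits_in Y p n f \<longleftrightarrow>
    (\<exists>R\<subseteq>cfunctions Y. finite R \<and> card R = n \<and>
      (\<forall>r\<in>R. \<forall>y\<in>topspace Y. poly (f (p y)) (r y) = 0))"

text \<open>
  Minimality is tested against coverings carried by the type \<^typ>\<open>(real \<Rightarrow> 'a) set\<close>.  This loses
  nothing: every path-connected covering of \<open>X\<close> is isomorphic to one of this kind, because a
  point \<open>y\<close> is determined by the set of images in \<open>X\<close> of all paths to \<open>y\<close> from a fixed point.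
  Accordingly, lemma \<open>splitting_covering_minimal\<close> below gives minimality with respect to
  coverings carried by arbitrary types.
\<close>

definition splitting_covering ::
  "'a topology \<Rightarrow> nat \<Rightarrow> ('a \<Rightarrow> complex poly) \<Rightarrow> 'b topology \<Rightarrow> ('b \<Rightarrow> 'a) \<Rightarrow> bool" where
  "splitting_covering X n f E q \<longleftrightarrow>
    path_connected_space E \<and> covering_map E X q \<and> splits_in E q n f \<and>
    (\<forall>(Y :: (real \<Rightarrow> 'a) set topology) p.
      path_connected_space Y \<and> covering_map Y X p \<and> splits_in Y p n f \<longrightarrow>
      (\<exists>\<phi>. covering_map_over Y p E q \<phi>))"


lemma covering_mapE:
  assumes "covering_map Y X p" "x \<in> topspace X"
  obtains U \<V> where "openin X U" "x \<in> U" "\<Union>\<V> = {y \<in> topspace Y. p y \<in> U}"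
    "\<And>V. V \<in> \<V> \<Longrightarrow> openin Y V" "pairwise disjnt \<V>"
    "\<And>V. V \<in> \<V> \<Longrightarrow> homeomorphic_map (subtopology Y V) (subtopology X U) p"
proof -
  have "\<exists>U. openin X U \<and> x \<in> U \<and>
      (\<exists>\<V>. \<Union>\<V> = {y \<in> topspace Y. p y \<in> U} \<and>
        (\<forall>V\<in>\<V>. openin Y V) \<and> pairwise disjnt \<V> \<and>
        (\<forall>V\<in>\<V>. homeomorphic_map (subtopology Y V) (subtopology X U) p))"
    using assms unfolding covering_map_def by (elim conjE) (rule bspec)
  then obtain U \<V> where *: "openin X U" "x \<in> U" "\<Union>\<V> = {y \<in> topspace Y. p y \<in> U}"
    "\<forall>V\<in>\<V>. openin Y V" "pairwise disjnt \<V>"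
    "\<forall>V\<in>\<V>. homeomorphic_map (subtopology Y V) (subtopology X U) p"
    by (elim exE conjE)
  show thesis
    by (rule that[of U \<V>]) (use * in simp_all)
qed

lemma covering_map_unique_path_lift:
  assumes cov: "covering_map Y X p"
    and \<alpha>: "pathin Y \<alpha>" and \<beta>: "pathin Y \<beta>"
    and eq: "\<And>t. t \<in> {0..1} \<Longrightarrow> p (\<alpha> t) = p (\<beta> t)" and start: "\<alpha> 0 = \<beta> 0"
    and t: "t \<in> {0..1}"
  shows "\<alpha> t = \<beta> t"
proof -
  let ?I = "top_of_set {0..1::real}"
  have c\<alpha>: "continuous_map ?I Y \<alpha>" and c\<beta>: "continuous_map ?I Y \<beta>"
    using \<alpha> \<beta> by (auto simp: pathin_def)
  have nbhd: "\<exists>T. openin ?I T \<and> s \<in> T \<and> (\<forall>u\<in>T. (\<alpha> u = \<beta> u) = (\<alpha> s = \<beta> s))"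
    if s: "s \<in> {0..1}" for s
  proof -
    have \<alpha>s: "\<alpha> s \<in> topspace Y" and \<beta>s: "\<beta> s \<in> topspace Y"
      using c\<alpha> c\<beta> s by (auto simp: continuous_map_def Pi_iff)
    then have "p (\<alpha> s) \<in> topspace X"
      using cov by (auto simp: covering_map_def)
    then obtain U \<V> where "openin X U" and U: "p (\<alpha> s) \<in> U" and V: "\<Union>\<V> = {y \<in> topspace Y. p y \<in> U}"
      "\<And>V. V \<in> \<V> \<Longrightarrow> openin Y V" "pairwise disjnt \<V>"
      "\<And>V. V \<in> \<V> \<Longrightarrow> homeomorphic_map (subtopology Y V) (subtopology X U) p"
      by (rule covering_mapE[OF cov]) blast
    obtain A where A: "A \<in> \<V>" "\<alpha> s \<in> A" using U V(1) \<alpha>s by blast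
    obtain B where B: "B \<in> \<V>" "\<beta> s \<in> B" using U V(1) \<beta>s eq[OF s] by fastforce
    have inj: "inj_on p A"
      using homeomorphic_imp_injective_map[OF V(4)[OF A(1)]] openin_subset[OF V(2)[OF A(1)]]
      by (simp add: Int_absorb1)
    let ?T = "{u \<in> topspace ?I. \<alpha> u \<in> A} \<inter> {u \<in> topspace ?I. \<beta> u \<in> B}"
    have "openin ?I ?T"
      by (intro openin_Int openin_continuous_map_preimage[OF c\<alpha>]
          openin_continuous_map_preimage[OF c\<beta>] V(2) A B)
    moreover have "s \<in> ?T" using s A B by simp
    moreover have "(\<alpha> u = \<beta> u) = (\<alpha> s = \<beta> s)" if u: "u \<in> ?T" for u
    proof (cases "A = B")
      case True
      then show ?thesis
        using inj u A B eq[of u] eq[OF s] by (auto simp: inj_on_def)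
    next
      case False
      then have "disjnt A B" using V(3) A B by (auto simp: pairwise_def)
      then show ?thesis using u A B by (auto simp: disjnt_iff)
    qed
    ultimately show ?thesis by blast
  qed
  have conn: "connected_space ?I"
    using connectedin_def[of euclidean "{0..1::real}"] by simp
  let ?S = "{s \<in> {0..1}. \<alpha> s = \<beta> s}" and ?D = "{s \<in> {0..1}. \<alpha> s \<noteq> \<beta> s}"
  have sub: "\<And>T. openin ?I T \<Longrightarrow> T \<subseteq> {0..1}"
    by (drule openin_subset) simp
  have op: "openin ?I {s \<in> {0..1}. (\<alpha> s = \<beta> s) = b}" for b
  proof (subst openin_subopen, intro ballI)
    fix s assume s: "s \<in> {s \<in> {0..1}. (\<alpha> s = \<beta> s) = b}"
    then obtain T where T: "openin ?I T" "s \<in> T" "\<forall>u\<in>T. (\<alpha> u = \<beta> u) = (\<alpha> s = \<beta> s)"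
      using nbhd[of s] by blast
    have "T \<subseteq> {s \<in> {0..1}. (\<alpha> s = \<beta> s) = b}"
    proof
      fix u assume "u \<in> T"
      then show "u \<in> {s \<in> {0..1}. (\<alpha> s = \<beta> s) = b}"
        using T(3) s sub[OF T(1)] by blast
    qed
    with T show "\<exists>T. openin ?I T \<and> s \<in> T \<and> T \<subseteq> {s \<in> {0..1}. (\<alpha> s = \<beta> s) = b}"
      by blast
  qed
  have "openin ?I ?S" "openin ?I ?D"
    using op[of True] op[of False] by simp_all
  moreover have "topspace ?I \<subseteq> ?S \<union> ?D" "?S \<inter> ?D = {}" "0 \<in> ?S" using start by auto
  ultimately have "?D = {}"
    using conn unfolding connected_space_def by blast
  with t show ?thesis by blast
qed

lemma covering_map_precompose_homeomorphism:
  assumes cov: "covering_map Y X p" and h: "homeomorphic_map Z Y h"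
  shows "covering_map Z X (p \<circ> h)"
  unfolding covering_map_def
proof (intro conjI ballI)
  show "continuous_map Z X (p \<circ> h)"
    using cov h by (meson continuous_map_compose covering_map_def homeomorphic_imp_continuous_map)
  have surj: "h ` topspace Z = topspace Y"
    using h by (simp add: homeomorphic_imp_surjective_map)
  then show "(p \<circ> h) ` topspace Z = topspace X"
    using cov unfolding covering_map_def image_comp [symmetric] by auto
  fix x assume "x \<in> topspace X"
  then obtain U \<V> where U: "openin X U" "x \<in> U" and V: "\<Union>\<V> = {y \<in> topspace Y. p y \<in> U}"
    "\<And>V. V \<in> \<V> \<Longrightarrow> openin Y V" "pairwise disjnt \<V>"
    "\<And>V. V \<in> \<V> \<Longrightarrow> homeomorphic_map (subtopology Y V) (subtopology X U) p"
    by (rule covering_mapE[OF cov]) blast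
  define pre where "pre V = {z \<in> topspace Z. h z \<in> V}" for V
  have "\<Union>(pre ` \<V>) = {z \<in> topspace Z. (p \<circ> h) z \<in> U}"
  proof -
    have "\<Union>(pre ` \<V>) = {z \<in> topspace Z. h z \<in> \<Union>\<V>}" by (auto simp: pre_def)
    then show ?thesis unfolding V(1) using surj by auto
  qed
  moreover have "openin Z W" if "W \<in> pre ` \<V>" for W
    using that V(2) h unfolding pre_def
    by (auto intro!: openin_continuous_map_preimage homeomorphic_imp_continuous_map)
  moreover have "pairwise disjnt (pre ` \<V>)"
    using V(3) by (fastforce simp: pairwise_def disjnt_iff pre_def)
  moreover have "homeomorphic_map (subtopology Z W) (subtopology X U) (p \<circ> h)"
    if W: "W \<in> pre ` \<V>" for W
  proof -
    obtain V where VV: "V \<in> \<V>" "W = pre V" using W by blast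
    have "h ` (topspace Z \<inter> W) = topspace Y \<inter> V"
      unfolding VV pre_def surj [symmetric] by auto
    then have "homeomorphic_map (subtopology Z W) (subtopology Y V) h"
      by (rule homeomorphic_map_subtopologies[OF h])
    then show ?thesis
      using V(4)[OF VV(1)] by (rule homeomorphic_map_compose)
  qed
  ultimately show "\<exists>U. openin X U \<and> x \<in> U \<and>
      (\<exists>\<V>. \<Union>\<V> = {z \<in> topspace Z. (p \<circ> h) z \<in> U} \<and> (\<forall>V\<in>\<V>. openin Z V) \<and>
        pairwise disjnt \<V> \<and> (\<forall>V\<in>\<V>. homeomorphic_map (subtopology Z V) (subtopology X U) (p \<circ> h)))"
    using U by (intro exI[of _ U] conjI exI[of _ "pre ` \<V>"]) auto
qed

lemma splits_in_precompose:
  assumes s: "splits_in Y p n f" and h: "continuous_map Z Y h" "h ` topspace Z = topspace Y"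
  shows "splits_in Z (p \<circ> h) n f"
proof -
  obtain R where R: "R \<subseteq> cfunctions Y" "finite R" "card R = n"
    "\<And>r y. r \<in> R \<Longrightarrow> y \<in> topspace Y \<Longrightarrow> poly (f (p y)) (r y) = 0"
    using s by (auto simp: splits_in_def)
  define g where "g r = restrict (r \<circ> h) (topspace Z)" for r :: "'a \<Rightarrow> complex"
  have hz: "h z \<in> topspace Y" if "z \<in> topspace Z" for z using h that by auto
  have "inj_on g R"
  proof (rule inj_onI)
    fix r r' assume rr: "r \<in> R" "r' \<in> R" "g r = g r'"
    show "r = r'"
    proof (rule extensionalityI)
      show "r \<in> extensional (topspace Y)" "r' \<in> extensional (topspace Y)"
        using rr R(1) by (auto simp: cfunctions_def)
      fix y assume "y \<in> topspace Y"
      then obtain z where z: "z \<in> topspace Z" "y = h z" using h by auto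
      then show "r y = r' y" using fun_cong[OF rr(3), of z] by (simp add: g_def)
    qed
  qed
  moreover have "g ` R \<subseteq> cfunctions Z"
  proof
    fix k assume "k \<in> g ` R"
    then obtain r where r: "r \<in> R" "k = g r" by blast
    have "continuous_map Y euclidean r" using R(1) r by (auto simp: cfunctions_def)
    then have "continuous_map Z euclidean (r \<circ> h)" using h(1) by (rule continuous_map_compose[rotated])
    then have "continuous_map Z euclidean k"
      by (rule continuous_map_eq) (auto simp: r g_def)
    then show "k \<in> cfunctions Z" by (simp add: r g_def cfunctions_def)
  qed
  moreover have "poly (f ((p \<circ> h) z)) (k z) = 0" if "k \<in> g ` R" "z \<in> topspace Z" for k z
    using that R(4) hz by (auto simp: g_def)
  ultimately show ?thesis
    unfolding splits_in_def using R(2,3)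
    by (intro exI[of _ "g ` R"]) (auto simp: card_image)
qed

lemma path_connected_covering_transfer:
  fixes X :: "'a topology" and Y :: "'b topology"
  assumes "path_connected_space Y" "covering_map Y X p"
  shows "\<exists>(Z :: (real \<Rightarrow> 'a) set topology) h k. homeomorphic_maps Y Z h k"
proof (cases "topspace Y = {}")
  case True
  then have "homeomorphic_maps Y (discrete_topology {}) (\<lambda>_. {}) (\<lambda>_. undefined)"
    by (auto simp: homeomorphic_maps_def continuous_map_def)
  then show ?thesis by blast
next
  case False
  then obtain b where b: "b \<in> topspace Y" by blast
  define j where
    "j y = {restrict (p \<circ> \<alpha>) {0..1} |\<alpha>. pathin Y \<alpha> \<and> \<alpha> 0 = b \<and> \<alpha> 1 = y}" for y
  have inj: "inj_on j (topspace Y)"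
  proof (rule inj_onI)
    fix y z assume y: "y \<in> topspace Y" and yz: "j y = j z"
    obtain \<alpha> where \<alpha>: "pathin Y \<alpha>" "\<alpha> 0 = b" "\<alpha> 1 = y"
      using assms(1) b y unfolding path_connected_space_def by blast
    then have "restrict (p \<circ> \<alpha>) {0..1} \<in> j y" by (auto simp: j_def)
    then obtain \<beta> where \<beta>: "pathin Y \<beta>" "\<beta> 0 = b" "\<beta> 1 = z"
      and eq: "restrict (p \<circ> \<alpha>) {0..1} = restrict (p \<circ> \<beta>) {0..1}"
      unfolding yz by (auto simp: j_def)
    have "p (\<alpha> t) = p (\<beta> t)" if "t \<in> {0..1}" for t
      using fun_cong[OF eq, of t] that by simp
    then have "\<alpha> 1 = \<beta> 1"
      using covering_map_unique_path_lift[OF assms(2) \<alpha>(1) \<beta>(1)] \<alpha>(2) \<beta>(2) by simp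
    then show "y = z" using \<alpha> \<beta> by simp
  qed
  define k where "k = inv_into (topspace Y) j"
  define Z where "Z = pullback_topology (j ` topspace Y) k Y"
  have kj: "k (j y) = y" if "y \<in> topspace Y" for y
    using that inj by (simp add: k_def)
  have topZ: "topspace Z = j ` topspace Y"
    unfolding Z_def topspace_pullback_topology using kj by auto
  have "continuous_map Z Y k"
    unfolding Z_def using continuous_map_pullback[OF continuous_map_id] by simp
  moreover have "continuous_map Y Z j"
    unfolding Z_def
    by (rule continuous_map_pullback') (auto intro: continuous_map_eq[OF continuous_map_id] simp: kj)
  ultimately have "homeomorphic_maps Y Z j k"
    unfolding homeomorphic_maps_def using kj topZ by auto
  then show ?thesis by blast
qed

lemma splitting_covering_minimal:
  fixes Y :: "'c topology"
  assumes E: "splitting_covering X n f E q"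
    and Y: "path_connected_space Y" "covering_map Y X p" "splits_in Y p n f"
  shows "\<exists>\<phi>. covering_map_over Y p E q \<phi>"
proof -
  obtain Z :: "(real \<Rightarrow> 'a) set topology" and h k where hk: "homeomorphic_maps Y Z h k"
    using path_connected_covering_transfer[OF Y(1,2)] by blast
  then have h: "homeomorphic_map Y Z h" and k: "homeomorphic_map Z Y k"
    and kh: "\<And>y. y \<in> topspace Y \<Longrightarrow> k (h y) = y"
    by (auto simp: homeomorphic_maps_map)
  have "path_connected_space Z"
    using Y(1) h homeomorphic_path_connected_space homeomorphic_map_imp_homeomorphic_space by blast
  moreover have "covering_map Z X (p \<circ> k)"
    by (rule covering_map_precompose_homeomorphism[OF Y(2) k])
  moreover have "splits_in Z (p \<circ> k) n f"
    using k by (intro splits_in_precompose[OF Y(3)] homeomorphic_imp_continuous_map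
        homeomorphic_imp_surjective_map)
  ultimately obtain \<phi> where \<phi>: "covering_map_over Z (p \<circ> k) E q \<phi>"
    using E unfolding splitting_covering_def by blast
  then have "covering_map Y E (\<phi> \<circ> h)"
    using covering_map_precompose_homeomorphism[OF _ h] by (auto simp: covering_map_over_def)
  moreover have "q ((\<phi> \<circ> h) y) = p y" if y: "y \<in> topspace Y" for y
  proof -
    have "h y \<in> topspace Z"
      using homeomorphic_imp_surjective_map[OF h] y by blast
    then show ?thesis using \<phi> kh[OF y] by (simp add: covering_map_over_def)
  qed
  ultimately show ?thesis by (auto simp: covering_map_over_def)
qed


section \<open>The absolute semi-topological Galois group\<close>

definition weierstrass_polynomials :: "'a topology \<Rightarrow> ('a \<Rightarrow> complex poly) set" where
  "weierstrass_polynomials X = {f. \<exists>n. weierstrass_polynomial X n f}"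

text \<open>
  A choice, for every Weierstrass polynomial \<open>f\<close>, of a splitting covering \<open>q f : E f \<rightarrow> X\<close> and of a
  point \<open>e f\<close> over \<open>x\<close>.  The inverse limit below is formed with respect to such a choice.
\<close>

definition pointed_splitting_system ::
  "'a topology \<Rightarrow> 'a \<Rightarrow> (('a \<Rightarrow> complex poly) \<Rightarrow> 'b topology) \<Rightarrow>
    (('a \<Rightarrow> complex poly) \<Rightarrow> 'b \<Rightarrow> 'a) \<Rightarrow> (('a \<Rightarrow> complex poly) \<Rightarrow> 'b) \<Rightarrow> bool" where
  "pointed_splitting_system X x E q e \<longleftrightarrow>
    (\<forall>n f. weierstrass_polynomial X n f \<longrightarrow>
      splitting_covering X n f (E f) (q f) \<and> e f \<in> topspace (E f) \<and> q f (e f) = x)"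

definition dominates :: "'b topology \<Rightarrow> ('b \<Rightarrow> 'a) \<Rightarrow> 'c topology \<Rightarrow> ('c \<Rightarrow> 'a) \<Rightarrow> bool" where
  "dominates Y p Z q \<longleftrightarrow> (\<exists>\<phi>. covering_map_over Y p Z q \<phi>)"

definition pointed_covering_map ::
  "'b topology \<Rightarrow> ('b \<Rightarrow> 'a) \<Rightarrow> 'b \<Rightarrow> 'c topology \<Rightarrow> ('c \<Rightarrow> 'a) \<Rightarrow> 'c \<Rightarrow> 'b \<Rightarrow> 'c" where
  "pointed_covering_map Y p y Z q z =
    (THE \<phi>. \<phi> \<in> extensional (topspace Y) \<and> covering_map_over Y p Z q \<phi> \<and> \<phi> y = z)"

definition deck_res ::
  "'b topology \<Rightarrow> ('b \<Rightarrow> 'a) \<Rightarrow> 'b \<Rightarrow> 'c topology \<Rightarrow> ('c \<Rightarrow> 'a) \<Rightarrow> 'c \<Rightarrow> ('b \<Rightarrow> 'b) \<Rightarrow> 'c \<Rightarrow> 'c" where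
  "deck_res Y p y Z q z \<sigma> =
    (THE \<tau>. \<tau> \<in> carrier (Deck Z q) \<and>
      (\<forall>u\<in>topspace Y. \<tau> (pointed_covering_map Y p y Z q z u)
                      = pointed_covering_map Y p y Z q z (\<sigma> u)))"

definition Pi_ST ::
  "'a topology \<Rightarrow> (('a \<Rightarrow> complex poly) \<Rightarrow> 'b topology) \<Rightarrow>
    (('a \<Rightarrow> complex poly) \<Rightarrow> 'b \<Rightarrow> 'a) \<Rightarrow> (('a \<Rightarrow> complex poly) \<Rightarrow> 'b) \<Rightarrow>
    (('a \<Rightarrow> complex poly) \<Rightarrow> 'b \<Rightarrow> 'b) monoid" where
  "Pi_ST X E q e =
    product_group (weierstrass_polynomials X) (\<lambda>f. Deck (E f) (q f))
      \<lparr>carrier := {s \<in> (\<Pi>\<^sub>E f\<in>weierstrass_polynomials X. carrier (Deck (E f) (q f))).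
        \<forall>f\<in>weierstrass_polynomials X. \<forall>g\<in>weierstrass_polynomials X.
          dominates (E f) (q f) (E g) (q g) \<longrightarrow>
          deck_res (E f) (q f) (e f) (E g) (q g) (e g) (s f) = s g}\<rparr>"

definition Pi_ST_topology ::
  "'a topology \<Rightarrow> (('a \<Rightarrow> complex poly) \<Rightarrow> 'b topology) \<Rightarrow>
    (('a \<Rightarrow> complex poly) \<Rightarrow> 'b \<Rightarrow> 'a) \<Rightarrow> (('a \<Rightarrow> complex poly) \<Rightarrow> 'b) \<Rightarrow>
    (('a \<Rightarrow> complex poly) \<Rightarrow> 'b \<Rightarrow> 'b) topology" where
  "Pi_ST_topology X E q e =
    subtopology
      (product_topology (\<lambda>f. discrete_topology (carrier (Deck (E f) (q f))))
        (weierstrass_polynomials X))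
      (carrier (Pi_ST X E q e))"


section \<open>Continuous cohomology with discrete coefficients\<close>

text \<open>
  The coefficient group is the additive group of \<open>A\<close>; no multiplication on \<open>A\<close> is used.  A group
  \<open>G\<close> and its topology \<open>T\<close> are separate arguments.
\<close>

definition discrete_module ::
  "('g, 'w) monoid_scheme \<Rightarrow> 'g topology \<Rightarrow> ('m, 'z) ring_scheme \<Rightarrow> ('g \<Rightarrow> 'm \<Rightarrow> 'm) \<Rightarrow> bool" where
  "discrete_module G T A act \<longleftrightarrow>
    abelian_group A \<and> group_action G (carrier A) act \<and>
    (\<forall>g\<in>carrier G. \<forall>a\<in>carrier A. \<forall>b\<in>carrier A. act g (a \<oplus>\<^bsub>A\<^esub> b) = act g a \<oplus>\<^bsub>A\<^esub> act g b) \<and>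
    (\<forall>a\<in>carrier A. openin T (stabilizer G act a))"

text \<open>An element of \<open>G^n\<close> is a function on \<^term>\<open>{..<n}\<close>, so \<open>(g_1, \<dots>, g_n)\<close> has index shifted by one.\<close>

definition tuples :: "('g, 'w) monoid_scheme \<Rightarrow> nat \<Rightarrow> (nat \<Rightarrow> 'g) set" where
  "tuples G n = ({..<n} \<rightarrow>\<^sub>E carrier G)"

definition cochains ::
  "('g, 'w) monoid_scheme \<Rightarrow> 'g topology \<Rightarrow> ('m, 'z) ring_scheme \<Rightarrow> nat \<Rightarrow>
    ((nat \<Rightarrow> 'g) \<Rightarrow> 'm) set" where
  "cochains G T A n =
    {c \<in> extensional (tuples G n).
      continuous_map (product_topology (\<lambda>_. T) {..<n}) (discrete_topology (carrier A)) c}"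

definition cochain_group ::
  "('g, 'w) monoid_scheme \<Rightarrow> 'g topology \<Rightarrow> ('m, 'z) ring_scheme \<Rightarrow> nat \<Rightarrow>
    ((nat \<Rightarrow> 'g) \<Rightarrow> 'm) monoid" where
  "cochain_group G T A n =
    \<lparr>carrier = cochains G T A n,
     mult = (\<lambda>c d. \<lambda>g\<in>tuples G n. c g \<oplus>\<^bsub>A\<^esub> d g),
     one = (\<lambda>g\<in>tuples G n. \<zero>\<^bsub>A\<^esub>)\<rparr>"

text \<open>\<open>merge_at G n i (g_1, \<dots>, g_{n+1}) = (g_1, \<dots>, g_i g_{i+1}, \<dots>, g_{n+1})\<close> for \<open>1 \<le> i \<le> n\<close>.\<close>

definition merge_at ::
  "('g, 'w) monoid_scheme \<Rightarrow> nat \<Rightarrow> nat \<Rightarrow> (nat \<Rightarrow> 'g) \<Rightarrow> nat \<Rightarrow> 'g" where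
  "merge_at G n i g =
    (\<lambda>j\<in>{..<n}. if j + 1 < i then g j
                else if j + 1 = i then g j \<otimes>\<^bsub>G\<^esub> g (j + 1)
                else g (j + 1))"

definition coboundary ::
  "('g, 'w) monoid_scheme \<Rightarrow> ('m, 'z) ring_scheme \<Rightarrow> ('g \<Rightarrow> 'm \<Rightarrow> 'm) \<Rightarrow> nat \<Rightarrow>
    ((nat \<Rightarrow> 'g) \<Rightarrow> 'm) \<Rightarrow> (nat \<Rightarrow> 'g) \<Rightarrow> 'm" where
  "coboundary G A act n c =
    (\<lambda>g\<in>tuples G (n + 1).
      act (g 0) (c (\<lambda>j\<in>{..<n}. g (j + 1)))
      \<oplus>\<^bsub>A\<^esub> (\<Oplus>\<^bsub>A\<^esub>i\<in>{1..n}. [((-1::int) ^ i)] \<cdot>\<^bsub>A\<^esub> c (merge_at G n i g))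
      \<oplus>\<^bsub>A\<^esub> [((-1::int) ^ (n + 1))] \<cdot>\<^bsub>A\<^esub> c (\<lambda>j\<in>{..<n}. g j))"

definition cocycles ::
  "('g, 'w) monoid_scheme \<Rightarrow> 'g topology \<Rightarrow> ('m, 'z) ring_scheme \<Rightarrow> ('g \<Rightarrow> 'm \<Rightarrow> 'm) \<Rightarrow> nat \<Rightarrow>
    ((nat \<Rightarrow> 'g) \<Rightarrow> 'm) set" where
  "cocycles G T A act n =
    {c \<in> cochains G T A n. coboundary G A act n c = \<one>\<^bsub>cochain_group G T A (n + 1)\<^esub>}"

definition coboundaries ::
  "('g, 'w) monoid_scheme \<Rightarrow> 'g topology \<Rightarrow> ('m, 'z) ring_scheme \<Rightarrow> ('g \<Rightarrow> 'm \<Rightarrow> 'm) \<Rightarrow> nat \<Rightarrow>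
    ((nat \<Rightarrow> 'g) \<Rightarrow> 'm) set" where
  "coboundaries G T A act n =
    (if n = 0 then {\<one>\<^bsub>cochain_group G T A 0\<^esub>}
     else coboundary G A act (n - 1) ` cochains G T A (n - 1))"

definition continuous_cohomology ::
  "('g, 'w) monoid_scheme \<Rightarrow> 'g topology \<Rightarrow> ('m, 'z) ring_scheme \<Rightarrow> ('g \<Rightarrow> 'm \<Rightarrow> 'm) \<Rightarrow> nat \<Rightarrow>
    ((nat \<Rightarrow> 'g) \<Rightarrow> 'm) set monoid" where
  "continuous_cohomology G T A act n =
    (cochain_group G T A n)\<lparr>carrier := cocycles G T A act n\<rparr> Mod coboundaries G T A act n"

definition H_ST ::
  "'a topology \<Rightarrow> (('a \<Rightarrow> complex poly) \<Rightarrow> 'b topology) \<Rightarrow>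
    (('a \<Rightarrow> complex poly) \<Rightarrow> 'b \<Rightarrow> 'a) \<Rightarrow> (('a \<Rightarrow> complex poly) \<Rightarrow> 'b) \<Rightarrow>
    ('m, 'z) ring_scheme \<Rightarrow> ((('a \<Rightarrow> complex poly) \<Rightarrow> 'b \<Rightarrow> 'b) \<Rightarrow> 'm \<Rightarrow> 'm) \<Rightarrow> nat \<Rightarrow>
    ((nat \<Rightarrow> ('a \<Rightarrow> complex poly) \<Rightarrow> 'b \<Rightarrow> 'b) \<Rightarrow> 'm) set monoid" where
  "H_ST X E q e A act n =
    continuous_cohomology (Pi_ST X E q e) (Pi_ST_topology X E q e) A act n"

end

theory Submission
  imports Defs
begin

text \<open>
  A loop of \<open>n\<close>-point configurations in the plane has a braid, and the braid of the loop of root sets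
  of \<open>f\<close> along a loop in \<open>X\<close> gives a homomorphism \<open>\<pi>\<^sub>1(X) \<rightarrow> B_n\<close> lifting the monodromy of the roots.
  If this homomorphism is trivial, the roots are continuous functions on \<open>X\<close>, so \<open>f\<close> splits in the
  identity covering; the rest is formal.

  The homomorphism is built without general position arguments.  Matsumoto's section
  \<open>S_n \<rightarrow> B_n\<close> assigns to an enumeration of a configuration from left to right, compared
  with its order by height, a positive braid.  Two nearby configurations give two
  enumerations of the same points; the quotient of their braids is the braid of the small motion
  between them.  It depends only on the order by height of the points that change sides, and these
  are well separated vertically, so it is multiplicative for configurations near a given one, and
  multiplying it along a subdivided path gives a homotopy invariant.
\<close>

section \<open>Local cocycles and their monodromy\<close>

text \<open>The lift to \<open>B_n\<close> is unavoidable, because braid-freeness says nothing about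
  homomorphisms to \<open>S_n\<close>: a finite group is braid-free, since \<open>B_n\<close> is
  torsion-free, yet it may act nontrivially by permutations. A path of root sets may have infinitely
  many crossings, so no braid word can be read off along it. For this reason the cocycle compares
  only the two ends of a short motion, whatever happens in between. Triviality of the monodromy
  gives a function \<Psi> with values in \<open>B_n\<close> such that the cocycle of two nearby
  points \<open>y\<close> and \<open>z\<close> is the inverse of \<open>\<Psi> y\<close> times
  \<open>\<Psi> z\<close>. The left-to-right list of the roots jumps where points change sides, and
  the permutation underlying the cocycle is the one by which it jumps. Reordering the list over each
  \<open>y\<close> by the inverse of \<open>\<Psi> y\<close> cancels the jumps, and the entries of
  the reordered list are the roots in \<open>C(X)\<close>.\<close>

text \<open>\<open>c\<close> need not be continuous for the discrete topology on \<open>G\<close>: it jumps in the application below.\<close>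

locale local_cocycle = group G for G (structure) +
  fixes X :: "'a topology" and c :: "'a \<Rightarrow> 'a \<Rightarrow> _"
  assumes c_closed: "\<And>x y. x \<in> topspace X \<Longrightarrow> y \<in> topspace X \<Longrightarrow> c x y \<in> carrier G"
    and locally_multiplicative: "\<And>x. x \<in> topspace X \<Longrightarrow>
      \<exists>U. openin X U \<and> x \<in> U \<and> (\<forall>u\<in>U. \<forall>v\<in>U. \<forall>w\<in>U. c u v \<otimes> c v w = c u w)"
begin

section \<open>Transport along paths and its homotopy invariance\<close>

lemma c_diag: assumes "x \<in> topspace X" shows "c x x = \<one>"
proof -
  obtain U where "x \<in> U" "\<forall>u\<in>U. \<forall>v\<in>U. \<forall>w\<in>U. c u v \<otimes> c v w = c u w"
    using locally_multiplicative[OF assms] by blast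
  then have "c x x \<otimes> c x x = c x x" by blast
  then show ?thesis
    using c_closed[OF assms assms] r_cancel_one by blast
qed

text \<open>\<open>\<psi>\<close> is a parallel section along \<open>\<gamma>\<close>: a short step
  away from \<open>s\<close> multiplies it on the right by the cocycle, with a radius that may
  depend on \<open>s\<close>. Left multiples of solutions are again solutions, so a solution can be
  normalised at one point.\<close>

definition compatible :: "real set \<Rightarrow> (real \<Rightarrow> 'a) \<Rightarrow> (real \<Rightarrow> _) \<Rightarrow> bool" where
  "compatible I \<gamma> \<psi> \<longleftrightarrow> \<psi> ` I \<subseteq> carrier G \<and>
    (\<forall>s\<in>I. \<exists>\<epsilon>>0. \<forall>t\<in>I. dist s t < \<epsilon> \<longrightarrow> \<psi> s \<otimes> c (\<gamma> s) (\<gamma> t) = \<psi> t)"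

definition transports :: "(real \<Rightarrow> 'a) \<Rightarrow> _ \<Rightarrow> bool" where
  "transports \<gamma> g \<longleftrightarrow> pathin X \<gamma> \<and> (\<exists>\<psi>. compatible {0..1} \<gamma> \<psi> \<and> \<psi> 0 = \<one> \<and> \<psi> 1 = g)"

lemma pathin_topspace: "pathin X \<gamma> \<Longrightarrow> t \<in> {0..1} \<Longrightarrow> \<gamma> t \<in> topspace X"
  by (auto simp: pathin_def continuous_map_def Pi_iff)

lemma compatible_mult:
  assumes "compatible I \<gamma> \<psi>" "a \<in> carrier G" "\<gamma> ` I \<subseteq> topspace X"
  shows "compatible I \<gamma> (\<lambda>t. a \<otimes> \<psi> t)"
  unfolding compatible_def
proof (intro conjI ballI)
  have cl: "\<psi> s \<in> carrier G" if "s \<in> I" for s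
    using assms(1) that by (auto simp: compatible_def)
  then show "(\<lambda>t. a \<otimes> \<psi> t) ` I \<subseteq> carrier G" using assms(2) by auto
  fix s assume s: "s \<in> I"
  then obtain \<epsilon> where e: "\<epsilon> > 0" "\<And>t. t \<in> I \<Longrightarrow> dist s t < \<epsilon> \<Longrightarrow> \<psi> s \<otimes> c (\<gamma> s) (\<gamma> t) = \<psi> t"
    using assms(1) by (auto simp: compatible_def)
  have "a \<otimes> \<psi> s \<otimes> c (\<gamma> s) (\<gamma> t) = a \<otimes> \<psi> t" if t: "t \<in> I" "dist s t < \<epsilon>" for t
  proof -
    have "c (\<gamma> s) (\<gamma> t) \<in> carrier G" using s t assms(3) by (intro c_closed) auto
    then show ?thesis using e(2)[OF t] cl[OF s] assms(2) by (metis m_assoc)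
  qed
  then show "\<exists>\<epsilon>>0. \<forall>t\<in>I. dist s t < \<epsilon> \<longrightarrow> a \<otimes> \<psi> s \<otimes> c (\<gamma> s) (\<gamma> t) = a \<otimes> \<psi> t"
    using e(1) by blast
qed

lemma compatible_imp_transports:
  assumes "pathin X \<gamma>" "compatible {0..1} \<gamma> \<psi>"
  shows "transports \<gamma> (inv (\<psi> 0) \<otimes> \<psi> 1)"
proof -
  have "\<psi> 0 \<in> carrier G" using assms(2) by (auto simp: compatible_def)
  moreover have "compatible {0..1} \<gamma> (\<lambda>t. inv (\<psi> 0) \<otimes> \<psi> t)"
    using assms calculation pathin_topspace by (intro compatible_mult) auto
  ultimately show ?thesis unfolding transports_def using assms(1) by (intro conjI exI) auto
qed

lemma transports_closed: "transports \<gamma> g \<Longrightarrow> g \<in> carrier G"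
  by (auto simp: transports_def compatible_def)

text \<open>By right cancellation, two solutions agree at \<open>s\<close> if and only if they agree
  at any point near \<open>s\<close>. The set where they agree is thus open and closed in the
  interval.\<close>

lemma compatible_unique:
  assumes \<gamma>: "pathin X \<gamma>" and \<psi>: "compatible {0..1} \<gamma> \<psi>" and \<psi>': "compatible {0..1} \<gamma> \<psi>'"
    and eq: "\<psi> 0 = \<psi>' 0" and t: "t \<in> {0..1}"
  shows "\<psi> t = \<psi>' t"
proof (rule connected_induction_simple[where S = "{0..1::real}" and a = 0 and P = "\<lambda>t. \<psi> t = \<psi>' t"])
  show "\<exists>T. openin (top_of_set {0..1}) T \<and> s \<in> T \<and> (\<forall>x\<in>T. \<forall>y\<in>T. \<psi> x = \<psi>' x \<longrightarrow> \<psi> y = \<psi>' y)"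
    if s: "s \<in> {0..1}" for s :: real
  proof -
    obtain \<epsilon> where e: "\<epsilon> > 0" "\<And>t. t \<in> {0..1} \<Longrightarrow> dist s t < \<epsilon> \<Longrightarrow> \<psi> s \<otimes> c (\<gamma> s) (\<gamma> t) = \<psi> t"
      using \<psi> s unfolding compatible_def by meson
    obtain \<epsilon>' where e': "\<epsilon>' > 0" "\<And>t. t \<in> {0..1} \<Longrightarrow> dist s t < \<epsilon>' \<Longrightarrow> \<psi>' s \<otimes> c (\<gamma> s) (\<gamma> t) = \<psi>' t"
      using \<psi>' s unfolding compatible_def by meson
    define T where "T = {0..1} \<inter> ball s (min \<epsilon> \<epsilon>')"
    have "(\<psi> x = \<psi>' x) = (\<psi> s = \<psi>' s)" if x: "x \<in> T" for x
    proof -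
      have "c (\<gamma> s) (\<gamma> x) \<in> carrier G" "\<psi> s \<in> carrier G" "\<psi>' s \<in> carrier G"
        using x s \<psi> \<psi>' by (auto simp: T_def compatible_def intro!: c_closed pathin_topspace[OF \<gamma>])
      moreover have "\<psi> s \<otimes> c (\<gamma> s) (\<gamma> x) = \<psi> x" "\<psi>' s \<otimes> c (\<gamma> s) (\<gamma> x) = \<psi>' x"
        using x by (auto simp: T_def intro!: e(2) e'(2))
      ultimately show ?thesis by (metis right_cancel)
    qed
    moreover have "openin (top_of_set {0..1}) T" "s \<in> T"
      using s e(1) e'(1) by (auto simp: T_def openin_open_Int)
    ultimately show ?thesis by blast
  qed
qed (use t eq in auto)

lemma transports_unique: "transports \<gamma> g \<Longrightarrow> transports \<gamma> h \<Longrightarrow> g = h"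
  unfolding transports_def using compatible_unique[of \<gamma> _ _ 1] by fastforce

text \<open>The value at \<open>s\<close> is the product of the cocycle along an equal subdivision
  of the segment from 0 to \<open>s\<close>, finer than a Lebesgue number of the cover by sets where
  \<open>c\<close> is multiplicative. The star-shaped \<open>K\<close> is the interval when a
  transport is constructed and the square when two homotopic loops are compared.\<close>

lemma compatible_exists:
  fixes K :: "'v::real_normed_vector set"
  assumes K: "compact K" and star: "\<And>s u. s \<in> K \<Longrightarrow> 0 \<le> u \<Longrightarrow> u \<le> 1 \<Longrightarrow> u *\<^sub>R s \<in> K"
    and F: "continuous_map (top_of_set K) X F"
  obtains \<psi> \<delta> where "\<psi> ` K \<subseteq> carrier G" "\<delta> > 0"
    "\<And>s t. s \<in> K \<Longrightarrow> t \<in> K \<Longrightarrow> dist s t < \<delta> \<Longrightarrow> \<psi> s \<otimes> c (F s) (F t) = \<psi> t"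
proof -
  define mult where "mult U \<longleftrightarrow> (\<forall>u\<in>U. \<forall>v\<in>U. \<forall>w\<in>U. c u v \<otimes> c v w = c u w)" for U
  define \<G> where "\<G> = {W. open W \<and> mult (F ` (K \<inter> W))}"
  have FX: "F s \<in> topspace X" if "s \<in> K" for s
    using F that by (auto simp: continuous_map_def Pi_iff)
  have "K \<subseteq> \<Union>\<G>"
  proof
    fix s assume s: "s \<in> K"
    obtain U where U: "openin X U" "F s \<in> U" "mult U"
      using locally_multiplicative[OF FX[OF s]] by (auto simp: mult_def)
    then have "openin (top_of_set K) {t \<in> topspace (top_of_set K). F t \<in> U}"
      by (intro openin_continuous_map_preimage[OF F])
    then obtain W where W: "open W" "{t \<in> K. F t \<in> U} = K \<inter> W"
      by (auto simp: openin_open)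
    then have "F ` (K \<inter> W) \<subseteq> U" by blast
    then have "W \<in> \<G>" using W U(3) unfolding \<G>_def mult_def by blast
    then show "s \<in> \<Union>\<G>" using W s U by blast
  qed
  then obtain \<delta> where d: "\<delta> > 0" "\<And>s. s \<in> K \<Longrightarrow> \<exists>W\<in>\<G>. ball s \<delta> \<subseteq> W"
    using Heine_Borel_lemma[OF K, of \<G>] unfolding \<G>_def by blast
  have coc: "c (F u) (F v) \<otimes> c (F v) (F w) = c (F u) (F w)"
    if "u \<in> K" "v \<in> K" "w \<in> K" "dist u v < \<delta>" "dist u w < \<delta>" for u v w
  proof -
    obtain W where W: "W \<in> \<G>" "ball u \<delta> \<subseteq> W" using d(2)[OF \<open>u \<in> K\<close>] by blast
    then have "u \<in> K \<inter> W" "v \<in> K \<inter> W" "w \<in> K \<inter> W" using that d(1) by auto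
    then show ?thesis using W(1) unfolding \<G>_def mult_def by blast
  qed
  obtain B where B: "\<And>s. s \<in> K \<Longrightarrow> norm s \<le> B" "B > 0"
    using compact_imp_bounded[OF K] bounded_pos by metis
  \<comment> \<open>Steps below \<delta>/2 and chains less than \<delta>/2 apart keep the diagonals
    in the ladder below \<delta>, as \<open>coc\<close> requires.\<close>
  obtain N :: nat where N: "N \<noteq> 0" "B / N < \<delta> / 2"
  proof -
    obtain N :: nat where "B / (\<delta> / 2) < N" using reals_Archimedean2 by blast
    moreover then have "0 < real N" using B(2) d(1) by (smt (verit) divide_pos_pos)
    ultimately show ?thesis using that[of N] d(1) B(2) by (simp add: field_simps)
  qed
  define p where "p s k = (real k / real N) *\<^sub>R s" for s :: 'v and k :: nat
  have pK: "p s k \<in> K" if "s \<in> K" "k \<le> N" for s k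
    using that N by (auto simp: p_def intro!: star)
  have pp: "dist (p s k) (p s (Suc k)) < \<delta> / 2" if "s \<in> K" for s k
  proof -
    have "p s (Suc k) - p s k = (1 / real N) *\<^sub>R s"
      unfolding p_def scaleR_left_diff_distrib[symmetric] by (simp add: diff_divide_distrib[symmetric])
    then have "dist (p s k) (p s (Suc k)) = norm s / N" by (metis dist_norm dist_commute norm_scaleR
          abs_of_nonneg divide_inverse inverse_eq_divide inverse_nonnegative_iff_nonnegative mult.commute of_nat_0_le_iff)
    also have "\<dots> \<le> B / N" using B(1)[OF that] by (simp add: divide_right_mono)
    finally show ?thesis using N(2) by linarith
  qed
  have pst: "dist (p s k) (p t k) \<le> dist s t" if "k \<le> N" for s t k
  proof -
    have "dist (p s k) (p t k) = real k / real N * dist s t"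
      by (simp add: p_def dist_norm scaleR_diff_right[symmetric])
    also have "\<dots> \<le> 1 * dist s t" using that N by (intro mult_right_mono) auto
    finally show ?thesis by simp
  qed
  define P where "P s = rec_nat \<one> (\<lambda>k g. g \<otimes> c (F (p s k)) (F (p s (Suc k))))" for s
  have P0: "P s 0 = \<one>" and PS: "P s (Suc k) = P s k \<otimes> c (F (p s k)) (F (p s (Suc k)))" for s k
    by (simp_all add: P_def)
  have Pcl: "P s k \<in> carrier G" if "s \<in> K" "k \<le> N" for s k
    using that(2) by (induction k) (auto simp: P0 PS intro!: m_closed c_closed FX pK that(1))
  \<comment> \<open>The subdivided segments to \<open>s\<close> and to \<open>t\<close> are the
    sides of a ladder. A rung passes to the next one through the diagonal from \<open>?a\<close> to
    \<open>?b'\<close>, by \<open>coc\<close> on the two triangles.\<close>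
  have ladder: "P s k \<otimes> c (F (p s k)) (F (p t k)) = P t k"
    if st: "s \<in> K" "t \<in> K" "dist s t < \<delta> / 2" and k: "k \<le> N" for s t k
    using k
  proof (induction k)
    case 0
    have "p s 0 = p t 0" by (simp add: p_def)
    then show ?case using pK[OF st(2), of 0] by (simp add: P0 c_diag FX)
  next
    case (Suc k)
    let ?a = "p s k" and ?b = "p s (Suc k)" and ?a' = "p t k" and ?b' = "p t (Suc k)"
    have K: "?a \<in> K" "?b \<in> K" "?a' \<in> K" "?b' \<in> K" using Suc.prems st by (auto intro!: pK)
    have cc: "c (F x) (F y) \<in> carrier G" if "x \<in> K" "y \<in> K" for x y
      using that by (intro c_closed FX)
    have dd: "dist ?a ?b < \<delta> / 2" "dist ?a' ?b' < \<delta> / 2" "dist ?a ?a' < \<delta> / 2" "dist ?b ?b' < \<delta> / 2"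
      using pp st pst[of k s t] pst[of "Suc k" s t] Suc.prems by (auto intro: le_less_trans)
    have ab': "dist ?a ?b' < \<delta>"
      using dist_triangle[of ?a ?b' ?b] dd by linarith
    have "P s (Suc k) \<otimes> c (F ?b) (F ?b') = P s k \<otimes> (c (F ?a) (F ?b) \<otimes> c (F ?b) (F ?b'))"
      using K Suc.prems st(1) by (simp add: PS m_assoc Pcl cc)
    also have "\<dots> = P s k \<otimes> c (F ?a) (F ?b')"
      using dd d(1) ab' by (subst coc) (auto simp: K)
    also have "\<dots> = P s k \<otimes> (c (F ?a) (F ?a') \<otimes> c (F ?a') (F ?b'))"
      using dd d(1) ab' by (subst coc) (auto simp: K)
    also have "\<dots> = (P s k \<otimes> c (F ?a) (F ?a')) \<otimes> c (F ?a') (F ?b')"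
      using K Suc.prems st(1) by (simp add: m_assoc Pcl cc)
    also have "\<dots> = P t (Suc k)" using Suc by (simp add: PS)
    finally show ?case .
  qed
  show thesis
  proof (rule that[of "\<lambda>s. P s N" "\<delta> / 2"])
    show "P s N \<otimes> c (F s) (F t) = P t N" if "s \<in> K" "t \<in> K" "dist s t < \<delta> / 2" for s t
      using ladder[OF that order.refl] N by (simp add: p_def)
  qed (use Pcl d in auto)
qed

lemma transports_exists:
  assumes "pathin X \<gamma>" shows "\<exists>g. transports \<gamma> g"
proof -
  obtain \<psi> \<delta> where "\<psi> ` {0..1::real} \<subseteq> carrier G" "\<delta> > 0"
    "\<And>s t. s \<in> {0..1} \<Longrightarrow> t \<in> {0..1} \<Longrightarrow> dist s t < \<delta> \<Longrightarrow> \<psi> s \<otimes> c (\<gamma> s) (\<gamma> t) = \<psi> t"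
    using compatible_exists[of "{0..1::real}" \<gamma>] assms by (auto simp: pathin_def mult_le_one)
  then have "compatible {0..1} \<gamma> \<psi>" unfolding compatible_def by blast
  then show ?thesis using compatible_imp_transports[OF assms] by blast
qed

text \<open>A solution on the whole square of the homotopy restricts to solutions along both loops.
  On the two sides where the homotopy rests at \<open>x\<close> it is constant, since
  \<open>c x x\<close> is one; so the two loops have the same end values.\<close>

lemma transports_homotopic:
  assumes h: "(\<gamma>, \<delta>) \<in> loop_rel X x" and \<gamma>: "transports \<gamma> g" and \<delta>: "transports \<delta> h"
  shows "g = h"
proof -
  have "\<exists>H. continuous_map (prod_topology (top_of_set {0..1}) (top_of_set {0..1})) X H \<and>
      (\<forall>s. H (0, s) = \<gamma> s) \<and> (\<forall>s. H (1, s) = \<delta> s) \<and> (\<forall>t\<in>{0..1::real}. H (t, 0::real) = x \<and> H (t, 1) = x)"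
    using h by (simp add: loop_rel_def homotopic_with_def)
  then obtain H :: "real \<times> real \<Rightarrow> 'a" where
      H: "continuous_map (prod_topology (top_of_set {0..1}) (top_of_set {0..1})) X H"
    and H01: "\<And>s. H (0, s) = \<gamma> s" "\<And>s. H (1, s) = \<delta> s"
    and Hx: "\<And>t. t \<in> {0..1} \<Longrightarrow> H (t, 0) = x \<and> H (t, 1) = x"
    by metis
  let ?K = "{0..1::real} \<times> {0..1::real}"
  have p\<gamma>: "pathin X \<gamma>" and p\<delta>: "pathin X \<delta>" using \<gamma> \<delta> by (auto simp: transports_def)
  have "prod_topology (top_of_set {0..1}) (top_of_set {0..1}) = top_of_set ?K"
    by (simp add: subtopology_Times[symmetric] euclidean_product_topology[symmetric])
  then have cont: "continuous_map (top_of_set ?K) X H" using H by simp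
  have comp: "compact ?K" by (simp add: compact_Times)
  have star: "u *\<^sub>R s \<in> ?K" if "s \<in> ?K" "0 \<le> u" "u \<le> 1" for s u
    using that by (auto simp: mult_le_one)
  obtain \<psi> d where \<psi>: "\<psi> ` ?K \<subseteq> carrier G" "d > 0"
    "\<And>s t. s \<in> ?K \<Longrightarrow> t \<in> ?K \<Longrightarrow> dist s t < d \<Longrightarrow> \<psi> s \<otimes> c (H s) (H t) = \<psi> t"
    by (rule compatible_exists[OF comp star cont]) blast+
  have row: "compatible {0..1} (\<lambda>s. H (t, s)) (\<lambda>s. \<psi> (t, s))" if "t \<in> {0..1}" for t
    unfolding compatible_def using \<psi> that
    by (auto simp: dist_Pair_Pair image_subset_iff intro!: exI[of _ d])
  have col: "compatible {0..1} (\<lambda>t. H (t, s)) (\<lambda>t. \<psi> (t, s))" if "s \<in> {0..1}" for s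
    unfolding compatible_def using \<psi> that
    by (auto simp: dist_Pair_Pair image_subset_iff intro!: exI[of _ d])
  have edge: "\<psi> (0, s) = \<psi> (1, s)" if "s \<in> {0, 1}" for s
  proof -
    have x: "x \<in> topspace X" using pathin_topspace[OF p\<gamma>, of 0] H01(1)[of 0] Hx[of 0] by auto
    have s: "s \<in> {0..1}" using that by auto
    have cl: "\<psi> (0, s) \<in> carrier G" using \<psi>(1) s by auto
    have "compatible {0..1} (\<lambda>_. x) (\<lambda>t. \<psi> (t, s))"
      using col[OF s] Hx that unfolding compatible_def by auto
    moreover have "compatible {0..1} (\<lambda>_. x) (\<lambda>t. \<psi> (0, s))"
      unfolding compatible_def using x cl by (auto simp: c_diag intro!: exI[of _ 1])
    moreover have "pathin X (\<lambda>_. x)" using x by (simp add: pathin_def)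
    ultimately show ?thesis using compatible_unique[of "\<lambda>_. x" "\<lambda>t. \<psi> (t, s)" "\<lambda>t. \<psi> (0, s)" 1] by simp
  qed
  have "compatible {0..1} \<gamma> (\<lambda>s. \<psi> (0, s))" "compatible {0..1} \<delta> (\<lambda>s. \<psi> (1, s))"
    using row[of 0] row[of 1] by (simp_all add: H01)
  then have "transports \<gamma> (inv \<psi> (0, 0) \<otimes> \<psi> (0, 1))" "transports \<delta> (inv \<psi> (1, 0) \<otimes> \<psi> (1, 1))"
    by (auto dest!: compatible_imp_transports[OF p\<gamma>] compatible_imp_transports[OF p\<delta>])
  then show "g = h" using \<gamma> \<delta> edge by (metis insertCI transports_unique)
qed

section \<open>Transport along concatenated and reversed paths\<close>

lemma pathin_concat:
  assumes "pathin X \<gamma>" "pathin X \<delta>" "\<gamma> 1 = \<delta> 0"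
  shows "pathin X (path_concat \<gamma> \<delta>)"
  unfolding pathin_def path_concat_def
proof (rule continuous_map_cases_le)
  let ?I = "top_of_set {0..1::real}"
  show "continuous_map ?I euclideanreal (\<lambda>t. t)" "continuous_map ?I euclideanreal (\<lambda>t. 1/2)"
    by (auto intro: continuous_map_from_subtopology)
  have "continuous_map (subtopology ?I {t \<in> topspace ?I. t \<le> 1/2}) ?I (\<lambda>t. 2 * t)"
    by (auto simp: continuous_map_in_subtopology subtopology_subtopology intro!: continuous_intros)
  from continuous_map_compose[OF this] 
  show "continuous_map (subtopology ?I {t \<in> topspace ?I. t \<le> 1/2}) X (\<lambda>t. \<gamma> (2 * t))"
    using assms(1) by (simp add: pathin_def o_def)
  have "continuous_map (subtopology ?I {t \<in> topspace ?I. 1/2 \<le> t}) ?I (\<lambda>t. 2 * t - 1)"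
    by (auto simp: continuous_map_in_subtopology subtopology_subtopology intro!: continuous_intros)
  from continuous_map_compose[OF this] 
  show "continuous_map (subtopology ?I {t \<in> topspace ?I. 1/2 \<le> t}) X (\<lambda>t. \<delta> (2 * t - 1))"
    using assms(2) by (simp add: pathin_def o_def)
  show "\<gamma> (2 * t) = \<delta> (2 * t - 1)" if "t = 1/2" for t
    unfolding that using assms(3) by simp
qed

text \<open>At the join each half contributes a radius, and the smaller one works. Away from the
  join the radius is cut down so that the other half is not reached.\<close>

lemma compatible_concat:
  assumes \<gamma>: "compatible {0..1} \<gamma> \<psi>" and \<delta>: "compatible {0..1} \<delta> \<phi>"
    and eq: "\<gamma> 1 = \<delta> 0" "\<psi> 1 = \<phi> 0"
  shows "compatible {0..1} (path_concat \<gamma> \<delta>) (\<lambda>t. if t \<le> 1/2 then \<psi> (2 * t) else \<phi> (2 * t - 1))"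
    (is "compatible _ _ ?\<chi>")
  unfolding compatible_def
proof (intro conjI ballI)
  show "?\<chi> ` {0..1} \<subseteq> carrier G"
    using \<gamma> \<delta> by (auto simp: compatible_def image_subset_iff)
  fix s :: real assume s: "s \<in> {0..1}"
  define P where "P t \<longleftrightarrow> ?\<chi> s \<otimes> c (path_concat \<gamma> \<delta> s) (path_concat \<gamma> \<delta> t) = ?\<chi> t" for t
  have left: "\<exists>e>0. \<forall>t\<in>{0..1/2}. dist s t < e \<longrightarrow> P t"
    if s': "s \<le> 1/2"
  proof -
    have "2 * s \<in> {0..1}" using s s' by auto
    then obtain e where e: "e > 0"
      "\<And>t. t \<in> {0..1} \<Longrightarrow> dist (2 * s) t < e \<Longrightarrow> \<psi> (2 * s) \<otimes> c (\<gamma> (2 * s)) (\<gamma> t) = \<psi> t"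
      using \<gamma> unfolding compatible_def by meson
    show ?thesis
    proof (intro exI[of _ "e / 2"] conjI ballI impI)
      fix t :: real assume t: "t \<in> {0..1/2}" "dist s t < e / 2"
      then have "dist (2 * s) (2 * t) < e" unfolding dist_real_def by linarith
      then show "P t" 
        unfolding P_def using e(2)[of "2 * t"] s' t by (auto simp: path_concat_def)
    qed (use e in auto)
  qed
  have right: "\<exists>e>0. \<forall>t\<in>{1/2..1}. dist s t < e \<longrightarrow> P t"
    if s': "s \<ge> 1/2"
  proof -
    have "2 * s - 1 \<in> {0..1}" using s s' by auto
    then obtain e where e: "e > 0"
      "\<And>t. t \<in> {0..1} \<Longrightarrow> dist (2 * s - 1) t < e \<Longrightarrow> \<phi> (2 * s - 1) \<otimes> c (\<delta> (2 * s - 1)) (\<delta> t) = \<phi> t"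
      using \<delta> unfolding compatible_def by meson
    \<comment> \<open>The midpoint falls under the first branch of both definitions; the matching
      end values allow it to be read in the second.\<close>
    have r: "?\<chi> t = \<phi> (2 * t - 1)" "path_concat \<gamma> \<delta> t = \<delta> (2 * t - 1)" if "t \<ge> 1/2" for t
    proof -
      have "?\<chi> t = \<phi> (2 * t - 1) \<and> path_concat \<gamma> \<delta> t = \<delta> (2 * t - 1)"
      proof (cases "t = 1/2")
        case True
        show ?thesis unfolding True using eq by (simp add: path_concat_def)
      next
        case False
        then show ?thesis using that by (simp add: path_concat_def)
      qed
      then show "?\<chi> t = \<phi> (2 * t - 1)" "path_concat \<gamma> \<delta> t = \<delta> (2 * t - 1)" by blast+
    qed
    show ?thesis
    proof (intro exI[of _ "e / 2"] conjI ballI impI)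
      fix t :: real assume t: "t \<in> {1/2..1}" "dist s t < e / 2"
      then have "dist (2 * s - 1) (2 * t - 1) < e" unfolding dist_real_def by linarith
      then show "P t" 
        unfolding P_def using e(2)[of "2 * t - 1"] t s' by (subst (1 2) r) (auto simp: r)
    qed (use e in auto)
  qed
  have "\<exists>e>0. \<forall>t\<in>{0..1}. dist s t < e \<longrightarrow> P t"
  proof -
    consider "s < 1/2" | "s = 1/2" | "s > 1/2" by linarith
    then show ?thesis
    proof cases
      case 1
      then obtain e where "e > 0" "\<forall>t\<in>{0..1/2}. dist s t < e \<longrightarrow> P t" using left by auto
      then show ?thesis using 1 by (intro exI[of _ "min e (1/2 - s)"]) (auto simp: dist_real_def)
    next
      case 2
      then obtain e e' where "e > 0" "\<forall>t\<in>{0..1/2}. dist s t < e \<longrightarrow> P t"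
         "e' > 0" "\<forall>t\<in>{1/2..1}. dist s t < e' \<longrightarrow> P t"
        using left right by (metis order.refl)
      moreover have "t \<in> {0..1/2} \<or> t \<in> {1/2..1}" if "t \<in> {0..1}" for t :: real
        using that by auto
      ultimately show ?thesis by (intro exI[of _ "min e e'"]) (metis min_less_iff_conj)
    next
      case 3
      then obtain e where "e > 0" "\<forall>t\<in>{1/2..1}. dist s t < e \<longrightarrow> P t" using right by auto
      then show ?thesis using 3 by (intro exI[of _ "min e (s - 1/2)"]) (auto simp: dist_real_def)
    qed
  qed
  then show "\<exists>e>0. \<forall>t\<in>{0..1}. dist s t < e \<longrightarrow> ?\<chi> s \<otimes> c (path_concat \<gamma> \<delta> s) (path_concat \<gamma> \<delta> t) = ?\<chi> t"
    unfolding P_def .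
qed

lemma transports_concat:
  assumes \<gamma>: "transports \<gamma> g" and \<delta>: "transports \<delta> h" and eq: "\<gamma> 1 = \<delta> 0"
  shows "transports (path_concat \<gamma> \<delta>) (g \<otimes> h)"
proof -
  obtain \<psi> where \<psi>: "compatible {0..1} \<gamma> \<psi>" "\<psi> 0 = \<one>" "\<psi> 1 = g" and p\<gamma>: "pathin X \<gamma>"
    using \<gamma> by (auto simp: transports_def)
  obtain \<phi> where \<phi>: "compatible {0..1} \<delta> \<phi>" "\<phi> 0 = \<one>" "\<phi> 1 = h" and p\<delta>: "pathin X \<delta>"
    using \<delta> by (auto simp: transports_def)
  have g: "g \<in> carrier G" using \<gamma> by (rule transports_closed)
  \<comment> \<open>The factor \<open>g\<close> makes the second solution start where the first one
    ends.\<close>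
  have "compatible {0..1} \<delta> (\<lambda>t. g \<otimes> \<phi> t)"
    using \<phi>(1) g pathin_topspace[OF p\<delta>] by (intro compatible_mult) auto
  from compatible_concat[OF \<psi>(1) this eq]
  have "compatible {0..1} (path_concat \<gamma> \<delta>)
      (\<lambda>t. if t \<le> 1/2 then \<psi> (2 * t) else g \<otimes> \<phi> (2 * t - 1))" (is "compatible _ _ ?\<chi>")
    using \<psi> \<phi> g by simp
  moreover have "?\<chi> 0 = \<one>" "?\<chi> 1 = g \<otimes> h" using \<psi> \<phi> by simp_all
  ultimately show ?thesis
    unfolding transports_def using pathin_concat[OF p\<gamma> p\<delta> eq] by blast
qed

lemma transports_reverse:
  assumes \<gamma>: "transports \<gamma> g"
  shows "transports (\<lambda>t. \<gamma> (1 - t)) (inv g)"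
proof -
  obtain \<psi> where \<psi>: "compatible {0..1} \<gamma> \<psi>" "\<psi> 0 = \<one>" "\<psi> 1 = g" and p\<gamma>: "pathin X \<gamma>"
    using \<gamma> by (auto simp: transports_def)
  have "continuous_map (top_of_set {0..1}) (top_of_set {0..1}) (\<lambda>t. 1 - t :: real)"
    by (auto simp: continuous_map_in_subtopology intro!: continuous_intros)
  from continuous_map_compose[OF this] have "pathin X (\<lambda>t. \<gamma> (1 - t))"
    using p\<gamma> by (simp add: pathin_def o_def)
  moreover have "compatible {0..1} (\<lambda>t. \<gamma> (1 - t)) (\<lambda>t. \<psi> (1 - t))"
    unfolding compatible_def
  proof (intro conjI ballI)
    fix s :: real assume "s \<in> {0..1}"
    then have "1 - s \<in> {0..1}" by simp
    then obtain e where e: "e > 0"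
      "\<And>t. t \<in> {0..1} \<Longrightarrow> dist (1 - s) t < e \<Longrightarrow> \<psi> (1 - s) \<otimes> c (\<gamma> (1 - s)) (\<gamma> t) = \<psi> t"
      using \<psi>(1) unfolding compatible_def by meson
    then show "\<exists>\<epsilon>>0. \<forall>t\<in>{0..1}. dist s t < \<epsilon> \<longrightarrow>
        \<psi> (1 - s) \<otimes> c (\<gamma> (1 - s)) (\<gamma> (1 - t)) = \<psi> (1 - t)"
      by (intro exI[of _ e]) (auto simp: dist_real_def)
  qed (use \<psi>(1) in \<open>auto simp: compatible_def image_subset_iff\<close>)
  ultimately have "transports (\<lambda>t. \<gamma> (1 - t)) (inv \<psi> (1 - 0) \<otimes> \<psi> (1 - 1))"
    by (rule compatible_imp_transports)
  then show ?thesis using \<psi> transports_closed[OF \<gamma>] by simp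
qed

text \<open>Transport is constant on homotopy classes and takes concatenation to multiplication, so
  it defines a homomorphism on the fundamental group, to which \<open>triv\<close> applies.\<close>

lemma trivial_transport:
  assumes triv: "\<And>h. h \<in> hom (fundamental_group X x) G \<Longrightarrow>
      \<forall>A\<in>carrier (fundamental_group X x). h A = \<one>"
    and \<gamma>: "\<gamma> \<in> loops_at X x" and g: "transports \<gamma> g"
  shows "g = \<one>"
proof -
  define T where "T \<gamma> = (THE g. transports \<gamma> g)" for \<gamma>
  have T: "transports \<gamma> (T \<gamma>)" if "pathin X \<gamma>" for \<gamma>
  proof -
    obtain g where "transports \<gamma> g" using transports_exists \<open>pathin X \<gamma>\<close> by blast
    then show ?thesis unfolding T_def by (rule theI) (rule transports_unique[OF _ \<open>transports \<gamma> g\<close>])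
  qed
  have loop: "pathin X \<gamma>" if "\<gamma> \<in> loops_at X x" for \<gamma> using that by (simp add: loops_at_def)
  define h where "h A = T (SOME \<gamma>. \<gamma> \<in> A)" for A
  have sub: "A \<subseteq> loops_at X x" if "A \<in> carrier (fundamental_group X x)" for A
  proof -
    have "A \<in> loops_at X x // loop_rel X x" using that by (simp add: fundamental_group_def)
    then show ?thesis using Union_quotient[OF equiv_loop_rel, of X x] by blast
  qed
  have h: "h A = T \<gamma>" if A: "A \<in> carrier (fundamental_group X x)" "\<gamma> \<in> A" for A \<gamma>
  proof -
    have A': "A \<in> loops_at X x // loop_rel X x" using A(1) by (simp add: fundamental_group_def)
    have s: "(SOME \<gamma>. \<gamma> \<in> A) \<in> A" using A(2) by (rule someI[of "\<lambda>\<gamma>. \<gamma> \<in> A"])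
    have "((SOME \<gamma>. \<gamma> \<in> A), \<gamma>) \<in> loop_rel X x"
      using quotient_eq_iff[OF equiv_loop_rel A' A' s A(2)] by simp
    moreover have "(SOME \<gamma>. \<gamma> \<in> A) \<in> loops_at X x" "\<gamma> \<in> loops_at X x"
      using sub[OF A(1)] s A(2) by auto
    ultimately show ?thesis
      unfolding h_def by (intro transports_homotopic[OF _ T[OF loop] T[OF loop]])
  qed
  have ne: "\<exists>\<gamma>. \<gamma> \<in> A" if "A \<in> carrier (fundamental_group X x)" for A
    using that in_quotient_imp_non_empty[OF equiv_loop_rel, of A X x] by (auto simp: fundamental_group_def)
  have "h \<in> hom (fundamental_group X x) G"
  proof (rule homI)
    fix A assume A: "A \<in> carrier (fundamental_group X x)"
    obtain \<gamma> where "\<gamma> \<in> A" using ne[OF A] by blast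
    then show "h A \<in> carrier G"
      using h[OF A] sub[OF A] transports_closed[OF T[OF loop]] by auto
    fix B assume B: "B \<in> carrier (fundamental_group X x)"
    obtain \<gamma> \<delta> where \<gamma>\<delta>: "\<gamma> \<in> A" "\<delta> \<in> B" using ne A B by blast
    let ?M = "A \<otimes>\<^bsub>fundamental_group X x\<^esub> B"
    have M: "?M = (\<Union>\<gamma>\<in>A. \<Union>\<delta>\<in>B. loop_rel X x `` {path_concat \<gamma> \<delta>})"
      by (simp add: fundamental_group_def)
    have conc: "transports (path_concat \<gamma> \<delta>) (h A \<otimes> h B)" if "\<gamma> \<in> A" "\<delta> \<in> B" for \<gamma> \<delta>
    proof -
      have "\<gamma> \<in> loops_at X x" "\<delta> \<in> loops_at X x" using that sub A B by auto
      then show ?thesis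
        using transports_concat[OF T[OF loop] T[OF loop], of \<gamma> \<delta>] h[OF A that(1)] h[OF B that(2)]
        by (simp add: loops_at_def)
    qed
    \<comment> \<open>The product of two classes is a union over all pairs of representatives, and
      \<open>h\<close> evaluates it at an arbitrary element. Hence the claim is shown for every
      element of the union.\<close>
    have MM: "T \<eta> = h A \<otimes> h B" if \<eta>: "\<eta> \<in> ?M" for \<eta>
    proof -
      obtain \<gamma> \<delta> where *: "\<gamma> \<in> A" "\<delta> \<in> B" "(path_concat \<gamma> \<delta>, \<eta>) \<in> loop_rel X x"
        using \<eta> unfolding M by blast
      then have "\<eta> \<in> loops_at X x"
        using equiv_loop_rel[of X x] by (auto simp: equiv_def refl_on_def)
      then show ?thesis using transports_homotopic[OF *(3) conc[OF *(1,2)] T[OF loop]] by simp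
    qed
    have "path_concat \<gamma> \<delta> \<in> loops_at X x"
      using subsetD[OF sub[OF A] \<gamma>\<delta>(1)] subsetD[OF sub[OF B] \<gamma>\<delta>(2)] conc[OF \<gamma>\<delta>]
      by (simp add: loops_at_def transports_def path_concat_def)
    from equiv_class_self[OF equiv_loop_rel this] have "path_concat \<gamma> \<delta> \<in> ?M"
      unfolding M using \<gamma>\<delta> by blast
    then have "(SOME \<eta>. \<eta> \<in> ?M) \<in> ?M" by (rule someI[of "\<lambda>\<eta>. \<eta> \<in> ?M"])
    then show "h ?M = h A \<otimes> h B" unfolding h_def[of ?M] by (rule MM)
  qed
  then have hA: "h A = \<one>" if "A \<in> carrier (fundamental_group X x)" for A
    using triv that by blast
  let ?A = "loop_rel X x `` {\<gamma>}"
  have "?A \<in> carrier (fundamental_group X x)" "\<gamma> \<in> ?A"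
    using quotientI[OF \<gamma>] equiv_class_self[OF equiv_loop_rel \<gamma>] by (auto simp: fundamental_group_def)
  then have "T \<gamma> = \<one>" using h[of ?A \<gamma>] hA[of ?A] by simp
  then show ?thesis using transports_unique[OF g T[OF loop[OF \<gamma>]]] by simp
qed

text \<open>\<open>\<Psi> y\<close> is the transport along any path from \<open>x\<close> to
  \<open>y\<close>: two such paths differ by a loop, whose transport is one. Inside a path-connected
  \<open>V\<close> on which \<open>c\<close> is multiplicative, the solution along a path from
  \<open>y\<close> is simply \<open>c y\<close> of its points, so its transport to \<open>z\<close>
  is \<open>c y z\<close>.\<close>

lemma trivial_monodromy_imp_coboundary:
  assumes pc: "path_connected_space X" and lpc: "locally_path_connected_space X"
    and x: "x \<in> topspace X"
    and triv: "\<And>h. h \<in> hom (fundamental_group X x) G \<Longrightarrow>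
      \<forall>A\<in>carrier (fundamental_group X x). h A = \<one>"
  obtains \<Psi> where "\<Psi> ` topspace X \<subseteq> carrier G"
    "\<And>y. y \<in> topspace X \<Longrightarrow> \<exists>V. openin X V \<and> y \<in> V \<and> (\<forall>z\<in>V. \<Psi> y \<otimes> c y z = \<Psi> z)"
proof -
  define \<Psi> where "\<Psi> y = (SOME g. \<exists>\<gamma>. \<gamma> 0 = x \<and> \<gamma> 1 = y \<and> transports \<gamma> g)" for y
  have unique: "g = h" if \<gamma>: "\<gamma> 0 = x" "transports \<gamma> g" and \<delta>: "\<delta> 0 = x" "transports \<delta> h"
    and eq: "\<gamma> 1 = \<delta> 1" for \<gamma> \<delta> g h
  proof -
    have gh: "g \<in> carrier G" "h \<in> carrier G" using \<gamma> \<delta> transports_closed by auto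
    have "transports (path_concat \<gamma> (\<lambda>t. \<delta> (1 - t))) (g \<otimes> inv h)"
      using \<gamma> \<delta> eq by (intro transports_concat transports_reverse) auto
    moreover from this have "path_concat \<gamma> (\<lambda>t. \<delta> (1 - t)) \<in> loops_at X x"
      using \<gamma> \<delta> by (auto simp: loops_at_def transports_def path_concat_def)
    ultimately have "g \<otimes> inv h = \<one>" by (intro trivial_transport[OF triv])
    then show ?thesis using gh inv_equality[of g "inv h"] by simp
  qed
  have \<Psi>: "\<exists>\<gamma>. \<gamma> 0 = x \<and> \<gamma> 1 = y \<and> transports \<gamma> (\<Psi> y)" if y: "y \<in> topspace X" for y
  proof -
    obtain \<gamma> where "pathin X \<gamma>" "\<gamma> 0 = x" "\<gamma> 1 = y"
      using pc[unfolded path_connected_space_def, rule_format, OF x y] by blast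
    then have "\<exists>g \<gamma>. \<gamma> 0 = x \<and> \<gamma> 1 = y \<and> transports \<gamma> g" using transports_exists by blast
    then show ?thesis unfolding \<Psi>_def by (rule someI_ex)
  qed
  show thesis
  proof (rule that)
    show "\<Psi> ` topspace X \<subseteq> carrier G" using \<Psi> transports_closed by blast
    fix y assume y: "y \<in> topspace X"
    obtain U where U: "openin X U" "y \<in> U" "\<forall>u\<in>U. \<forall>v\<in>U. \<forall>w\<in>U. c u v \<otimes> c v w = c u w"
      using locally_multiplicative[OF y] by blast
    obtain V where V: "openin X V" "path_connectedin X V" "y \<in> V" "V \<subseteq> U"
      using lpc U(1,2) unfolding locally_path_connected_space_alt neighbourhood_base_of by blast
    have "\<Psi> y \<otimes> c y z = \<Psi> z" if z: "z \<in> V" for z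
    proof -
      obtain \<gamma> where \<gamma>: "pathin X \<gamma>" "\<gamma> \<in> {0..1} \<rightarrow> V" "\<gamma> 0 = y" "\<gamma> 1 = z"
        using V z unfolding path_connectedin by blast
      have "\<gamma> t \<in> U" "\<gamma> t \<in> topspace X" if "t \<in> {0..1}" for t
        using \<gamma>(2) that V(4) openin_subset[OF V(1)] by auto
      then have "compatible {0..1} \<gamma> (\<lambda>t. c y (\<gamma> t))"
        unfolding compatible_def using U y by (auto intro!: c_closed exI[of _ 1])
      then have "transports \<gamma> (c y z)"
        unfolding transports_def using \<gamma> c_diag[OF y] by auto
      moreover obtain \<delta> where \<delta>: "\<delta> 0 = x" "\<delta> 1 = y" "transports \<delta> (\<Psi> y)" using \<Psi>[OF y] by blast
      ultimately have "transports (path_concat \<delta> \<gamma>) (\<Psi> y \<otimes> c y z)"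
        using \<gamma> by (intro transports_concat) auto
      moreover have "z \<in> topspace X" using z openin_subset[OF V(1)] by auto
      then obtain \<eta> where "\<eta> 0 = x" "\<eta> 1 = z" "transports \<eta> (\<Psi> z)" using \<Psi> by blast
      ultimately show ?thesis
        using \<delta> \<gamma> by (intro unique[of "path_concat \<delta> \<gamma>" _ \<eta>]) (auto simp: path_concat_def)
    qed
    then show "\<exists>V. openin X V \<and> y \<in> V \<and> (\<forall>z\<in>V. \<Psi> y \<otimes> c y z = \<Psi> z)" using V by blast
  qed
qed

end


section \<open>Adjacent swaps and inversions of lists\<close>

definition swap_at :: "nat \<Rightarrow> 'a list \<Rightarrow> 'a list" where
  "swap_at i xs = xs[i := xs ! Suc i, Suc i := xs ! i]"

lemma length_swap_at [simp]: "length (swap_at i xs) = length xs"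
  by (simp add: swap_at_def)

lemma nth_swap_at:
  "k < length xs \<Longrightarrow> swap_at i xs ! k = (if k = i then xs ! Suc i else if k = Suc i then xs ! i else xs ! k)"
  by (auto simp: swap_at_def nth_list_update)

lemma set_swap_at [simp]: "Suc i < length xs \<Longrightarrow> set (swap_at i xs) = set xs"
  unfolding swap_at_def by (rule set_swap) auto

lemma distinct_swap_at [simp]: "Suc i < length xs \<Longrightarrow> distinct (swap_at i xs) = distinct xs"
  unfolding swap_at_def by (rule distinct_swap) auto

lemma map_swap_at: "Suc i < length xs \<Longrightarrow> map f (swap_at i xs) = swap_at i (map f xs)"
  by (auto simp: swap_at_def map_update)

lemma swap_at_swap_at: "Suc i < length xs \<Longrightarrow> swap_at i (swap_at i xs) = xs"
  by (rule nth_equalityI) (auto simp: nth_swap_at)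

definition inversions :: "('a \<Rightarrow> 'a \<Rightarrow> bool) \<Rightarrow> 'a list \<Rightarrow> (nat \<times> nat) set" where
  "inversions R xs = {(i, j). i < j \<and> j < length xs \<and> R (xs ! j) (xs ! i)}"

lemma finite_inversions: "finite (inversions R xs)"
  by (rule finite_subset[of _ "{..<length xs} \<times> {..<length xs}"]) (auto simp: inversions_def)

text \<open>The transposition of the positions \<open>i\<close> and \<open>Suc i\<close> injects the
  inversions after the swap into those before it. It keeps the order of every pair of positions but
  \<open>(i, Suc i)\<close>, and this pair is an inversion before the swap and none after
  it.\<close>

lemma card_inversions_swap_at:
  assumes i: "Suc i < length xs" and R: "R (xs ! Suc i) (xs ! i)" "\<not> R (xs ! i) (xs ! Suc i)"
  shows "card (inversions R (swap_at i xs)) < card (inversions R xs)"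
proof -
  define \<tau> where "\<tau> k = (if k = i then Suc i else if k = Suc i then i else k)" for k
  have sw: "swap_at i xs ! k = xs ! \<tau> k" if "k < length xs" for k
    using that by (simp add: nth_swap_at \<tau>_def)
  have inj: "inj \<tau>" by (auto simp: inj_def \<tau>_def split: if_splits)
  have "map_prod \<tau> \<tau> ` inversions R (swap_at i xs) \<subseteq> inversions R xs - {(i, Suc i)}"
  proof (rule image_subsetI)
    fix p assume p: "p \<in> inversions R (swap_at i xs)"
    obtain k l where kl: "p = (k, l)" by (cases p)
    then have *: "k < l" "l < length xs" "R (xs ! \<tau> l) (xs ! \<tau> k)"
      using p sw by (auto simp: inversions_def)
    have "(k, l) \<noteq> (i, Suc i)" using *(3) R by (auto simp: \<tau>_def)
    then have "\<tau> k < \<tau> l" "(\<tau> k, \<tau> l) \<noteq> (i, Suc i)" "\<tau> l < length xs"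
      using * i by (auto simp: \<tau>_def split: if_splits)
    then show "map_prod \<tau> \<tau> p \<in> inversions R xs - {(i, Suc i)}"
      using * kl by (auto simp: inversions_def)
  qed
  moreover have "inj_on (map_prod \<tau> \<tau>) (inversions R (swap_at i xs))"
    by (rule inj_on_subset[OF prod.inj_map[OF inj inj]]) simp
  ultimately have "card (inversions R (swap_at i xs)) \<le> card (inversions R xs - {(i, Suc i)})"
    by (simp add: card_inj_on_le finite_inversions)
  also have "\<dots> < card (inversions R xs)"
    by (rule card_Diff1_less) (use i R finite_inversions[of R xs] in \<open>auto simp: inversions_def\<close>)
  finally show ?thesis .
qed

lemma sorted_wrt_unique:
  assumes "sorted_wrt R xs" "sorted_wrt R ys" "set xs = set ys"
    and asym: "\<And>x y. R x y \<Longrightarrow> \<not> R y x"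
  shows "xs = ys"
  using assms(1-3)
proof (induction xs arbitrary: ys)
  case (Cons x xs)
  then obtain y ys' where ys: "ys = y # ys'" by (cases ys) auto
  have irrefl: "\<not> R z z" for z using asym by blast
  have x: "x \<notin> set xs" and y: "y \<notin> set ys'" using Cons.prems(1,2) ys irrefl by auto
  have "x = y"
  proof (rule ccontr)
    assume "x \<noteq> y"
    then have "x \<in> set ys'" "y \<in> set xs" using Cons.prems(3) ys by auto
    then show False using Cons.prems(1,2) ys asym by auto
  qed
  then show ?case using Cons.prems x y ys by (auto intro!: Cons.IH)
qed simp

definition before :: "'a list \<Rightarrow> 'a \<Rightarrow> 'a \<Rightarrow> bool" where
  "before xs x y \<longleftrightarrow> (\<exists>k l. k < l \<and> l < length xs \<and> xs ! k = x \<and> xs ! l = y)"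

lemma before_asym: "distinct xs \<Longrightarrow> before xs x y \<Longrightarrow> \<not> before xs y x"
  unfolding before_def by (metis distinct_conv_nth less_trans not_less_iff_gr_or_eq)

lemma before_trans: "distinct xs \<Longrightarrow> before xs x y \<Longrightarrow> before xs y z \<Longrightarrow> before xs x z"
  unfolding before_def by (metis distinct_conv_nth less_trans)

lemma before_total: "x \<in> set xs \<Longrightarrow> y \<in> set xs \<Longrightarrow> x \<noteq> y \<Longrightarrow> before xs x y \<or> before xs y x"
  unfolding before_def by (metis in_set_conv_nth linorder_neqE_nat)

lemma sorted_wrt_before: "sorted_wrt (before xs) xs"
  unfolding sorted_wrt_iff_nth_less before_def by blast

lemma before_swap_at:
  assumes "Suc i < length xs" "before (swap_at i xs) x y"
  shows "before xs x y \<or> x = xs ! Suc i \<and> y = xs ! i"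
proof -
  obtain k l where kl: "k < l" "l < length xs" "swap_at i xs ! k = x" "swap_at i xs ! l = y"
    using assms(2) by (auto simp: before_def)
  define \<tau> where "\<tau> k = (if k = i then Suc i else if k = Suc i then i else k)" for k
  have xy: "x = xs ! \<tau> k" "y = xs ! \<tau> l" using kl by (auto simp: nth_swap_at \<tau>_def)
  show ?thesis
  proof (cases "k = i \<and> l = Suc i")
    case True
    then show ?thesis using xy by (simp add: \<tau>_def)
  next
    case False
    then have "\<tau> k < \<tau> l" "\<tau> l < length xs" using kl assms(1) by (auto simp: \<tau>_def split: if_splits)
    then show ?thesis using xy unfolding before_def by blast
  qed
qed

text \<open>This is bubble sort of \<open>us\<close> towards the order of \<open>vs\<close>. Only
  pairs that stand in the wrong order are ever exchanged, which later limits the pairs of points on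
  which a braid depends.\<close>

lemma swap_induct [consumes 3, case_names refl swap]:
  assumes "distinct us" "distinct vs" "set us = set vs"
    and refl: "P vs"
    and step: "\<And>us i. distinct us \<Longrightarrow> set us = set vs \<Longrightarrow> Suc i < length us \<Longrightarrow>
      before vs (us ! Suc i) (us ! i) \<Longrightarrow> P (swap_at i us) \<Longrightarrow> P us"
  shows "P us"
  using assms(1,3)
proof (induction "card (inversions (before vs) us)" arbitrary: us rule: less_induct)
  case less
  show ?case
  proof (cases "\<exists>i. Suc i < length us \<and> before vs (us ! Suc i) (us ! i)")
    case True
    then obtain i where i: "Suc i < length us" "before vs (us ! Suc i) (us ! i)" by blast
    have "card (inversions (before vs) (swap_at i us)) < card (inversions (before vs) us)"
      using i before_asym[OF assms(2) i(2)] by (intro card_inversions_swap_at)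
    then have "P (swap_at i us)" using less i by simp
    then show ?thesis using step less.prems i by blast
  next
    case False
    have "before vs (us ! i) (us ! Suc i)" if "Suc i < length us" for i
    proof -
      have "us ! i \<in> set vs" "us ! Suc i \<in> set vs" "us ! i \<noteq> us ! Suc i"
        using that less.prems nth_eq_iff_index_eq[of us i "Suc i"] by (auto simp flip: less.prems(2))
      then show ?thesis using before_total False that by fast
    qed
    moreover have "transp (before vs)" using before_trans[OF assms(2)] by (auto simp: transp_def)
    ultimately have "sorted_wrt (before vs) us" by (simp add: sorted_wrt_iff_nth_Suc_transp)
    then have "us = vs"
      using sorted_wrt_unique[OF _ sorted_wrt_before less.prems(2) before_asym[OF assms(2)]] by blast
    then show ?thesis using refl by simp
  qed
qed


section \<open>Positive permutation braids\<close>

abbreviation braid_class :: "nat \<Rightarrow> (nat \<times> bool) list \<Rightarrow> (nat \<times> bool) list set" where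
  "braid_class n u \<equiv> braid_rel n `` {u}"

definition braid_gen :: "nat \<Rightarrow> nat \<Rightarrow> (nat \<times> bool) list set" where
  "braid_gen n i = braid_class n [(i, True)]"

lemma braid_class_closed: "u \<in> braid_words n \<Longrightarrow> braid_class n u \<in> carrier (braid_group n)"
  by (auto simp: braid_group_def quotient_def)

lemma braid_class_eq: "braid_eq n u v \<Longrightarrow> braid_class n u = braid_class n v"
  by (rule equiv_class_eq[OF equiv_braid_rel]) (simp add: braid_rel_def)

lemma one_braid_group: "\<one>\<^bsub>braid_group n\<^esub> = braid_class n []"
  by (simp add: braid_group_def)

lemma braid_gen_closed: "i \<in> {1..<n} \<Longrightarrow> braid_gen n i \<in> carrier (braid_group n)"
  unfolding braid_gen_def by (rule braid_class_closed) (auto simp: braid_words_def)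

lemma braid_gen_far_commute:
  assumes "1 \<le> i" "i + 2 \<le> j" "j < n"
  shows "braid_gen n i \<otimes>\<^bsub>braid_group n\<^esub> braid_gen n j = braid_gen n j \<otimes>\<^bsub>braid_group n\<^esub> braid_gen n i"
  unfolding braid_gen_def using assms braid_class_eq[OF braid_eq.far_commute[OF assms]]
  by (subst (1 2) braid_mult_class) (auto simp: braid_words_def)

lemma braid_gen_braid:
  assumes "1 \<le> i" "i + 1 < n"
  shows "braid_gen n i \<otimes>\<^bsub>braid_group n\<^esub> braid_gen n (i + 1) \<otimes>\<^bsub>braid_group n\<^esub> braid_gen n i =
    braid_gen n (i + 1) \<otimes>\<^bsub>braid_group n\<^esub> braid_gen n i \<otimes>\<^bsub>braid_group n\<^esub> braid_gen n (i + 1)"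
proof -
  have w: "[(i, True)] \<in> braid_words n" "[(i + 1, True)] \<in> braid_words n"
    "[(i, True), (i + 1, True)] \<in> braid_words n" "[(i + 1, True), (i, True)] \<in> braid_words n"
    using assms by (auto simp: braid_words_def)
  show ?thesis
    unfolding braid_gen_def using w braid_class_eq[OF braid_eq.braid[OF assms]]
    by (simp add: braid_mult_class)
qed

text \<open>Points of the plane are ordered by height; ties do occur and are broken by the real part.\<close>

definition lower :: "complex \<Rightarrow> complex \<Rightarrow> bool" where
  "lower z w \<longleftrightarrow> Im z < Im w \<or> Im z = Im w \<and> Re z < Re w"

lemma lower_asym: "lower z w \<Longrightarrow> \<not> lower w z"
  and lower_trans: "lower z w \<Longrightarrow> lower w v \<Longrightarrow> lower z v"
  and lower_total: "z \<noteq> w \<Longrightarrow> lower z w \<or> lower w z"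
  by (auto simp: lower_def complex_eq_iff)

text \<open>The positive permutation braid leading from the enumeration by height to
  \<open>xs\<close>; the generator of the descent undone first stands last. List positions count
  from 0 and generators from 1, whence \<open>Suc i\<close>.\<close>

function braid_of :: "complex list \<Rightarrow> (nat \<times> bool) list set" where
  "braid_of xs =
    (if \<exists>i. Suc i < length xs \<and> lower (xs ! Suc i) (xs ! i)
     then let i = SOME i. Suc i < length xs \<and> lower (xs ! Suc i) (xs ! i)
          in braid_of (swap_at i xs) \<otimes>\<^bsub>braid_group (length xs)\<^esub> braid_gen (length xs) (Suc i)
     else \<one>\<^bsub>braid_group (length xs)\<^esub>)"
  by pat_completeness auto
termination
proof (relation "Wellfounded.measure (\<lambda>xs. card (inversions lower xs))")
  fix xs :: "complex list" and i
  assume "\<exists>i. Suc i < length xs \<and> lower (xs ! Suc i) (xs ! i)"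
    and i: "i = (SOME i. Suc i < length xs \<and> lower (xs ! Suc i) (xs ! i))"
  then have "Suc i < length xs \<and> lower (xs ! Suc i) (xs ! i)"
    using someI_ex[of "\<lambda>i. Suc i < length xs \<and> lower (xs ! Suc i) (xs ! i)"] by simp
  then show "(swap_at i xs, xs) \<in> Wellfounded.measure (\<lambda>xs. card (inversions lower xs))"
    using lower_asym by (auto intro!: card_inversions_swap_at)
qed simp

declare braid_of.simps [simp del]

lemma braid_of_sorted:
  "(\<And>i. Suc i < length xs \<Longrightarrow> \<not> lower (xs ! Suc i) (xs ! i)) \<Longrightarrow> braid_of xs = \<one>\<^bsub>braid_group (length xs)\<^esub>"
  by (subst braid_of.simps) auto

text \<open>
  The choice of the descent is immaterial: two descents at distance at least two may be undone in
  either order, and two adjacent ones amount to the two sides of the braid relation.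
\<close>

lemma braid_of_descent_closed:
  assumes "length xs = n"
  shows "braid_of xs \<in> carrier (braid_group n) \<and>
    (\<forall>i. Suc i < n \<longrightarrow> lower (xs ! Suc i) (xs ! i) \<longrightarrow>
      braid_of xs = braid_of (swap_at i xs) \<otimes>\<^bsub>braid_group n\<^esub> braid_gen n (Suc i))"
  using assms
\<comment> \<open>Membership in the carrier is carried along in the induction, because regrouping
  the products of shorter braids depends on it.\<close>
proof (induction "card (inversions lower xs)" arbitrary: xs rule: less_induct)
  case less
  interpret group "braid_group n" by (rule group_braid_group)
  note len = less.prems
  let ?D = "\<lambda>xs i. Suc i < n \<and> lower (xs ! Suc i) (xs ! i)"
  let ?s = "braid_gen n"
  have dec: "card (inversions lower (swap_at i ys)) < card (inversions lower ys)"
    if "?D ys i" "length ys = n" for ys i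
    using that lower_asym by (auto intro!: card_inversions_swap_at)
  have cl: "braid_of (swap_at i xs) \<in> carrier (braid_group n)" if "?D xs i" for i
    using less.hyps[of "swap_at i xs"] dec[OF that len] len by simp
  have IH: "braid_of (swap_at i xs) = braid_of (swap_at j (swap_at i xs)) \<otimes>\<^bsub>braid_group n\<^esub> ?s (Suc j)"
    if "?D xs i" "?D (swap_at i xs) j" for i j
    using less.hyps[of "swap_at i xs"] dec[OF that(1) len] len that(2) by simp
  have cl2: "braid_of (swap_at j (swap_at i xs)) \<in> carrier (braid_group n)"
    if "?D xs i" "?D (swap_at i xs) j" for i j
    using less.hyps[of "swap_at j (swap_at i xs)"] dec[OF that(1) len] dec[OF that(2)] len by simp
  have IH2: "braid_of (swap_at j (swap_at i xs)) =
      braid_of (swap_at k (swap_at j (swap_at i xs))) \<otimes>\<^bsub>braid_group n\<^esub> ?s (Suc k)"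
    and cl3: "braid_of (swap_at k (swap_at j (swap_at i xs))) \<in> carrier (braid_group n)"
    if "?D xs i" "?D (swap_at i xs) j" "?D (swap_at j (swap_at i xs)) k" for i j k
    using less.hyps[of "swap_at j (swap_at i xs)"] less.hyps[of "swap_at k (swap_at j (swap_at i xs))"]
      dec[OF that(1) len] dec[OF that(2)] dec[OF that(3)] len that(3) by simp_all
  have s: "?s (Suc i) \<in> carrier (braid_group n)" if "Suc i < n" for i
    using that by (intro braid_gen_closed) simp
  have far: "braid_of (swap_at i xs) \<otimes>\<^bsub>braid_group n\<^esub> ?s (Suc i) =
      braid_of (swap_at j xs) \<otimes>\<^bsub>braid_group n\<^esub> ?s (Suc j)"
    if D: "?D xs i" "?D xs j" and ij: "i + 2 \<le> j" for i j
  proof -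
    have D': "?D (swap_at i xs) j" "?D (swap_at j xs) i"
      using D ij len by (auto simp: nth_swap_at)
    have sw: "swap_at j (swap_at i xs) = swap_at i (swap_at j xs)"
      using D ij len by (intro nth_equalityI) (auto simp: nth_swap_at)
    have comm: "?s (Suc i) \<otimes>\<^bsub>braid_group n\<^esub> ?s (Suc j) = ?s (Suc j) \<otimes>\<^bsub>braid_group n\<^esub> ?s (Suc i)"
      using D ij by (intro braid_gen_far_commute) auto
    show ?thesis
      unfolding IH[OF D(1) D'(1)] IH[OF D(2) D'(2)] sw
      using s D cl2[OF D(2) D'(2)] by (simp add: m_assoc comm)
  qed
  have adj: "braid_of (swap_at i xs) \<otimes>\<^bsub>braid_group n\<^esub> ?s (Suc i) =
      braid_of (swap_at j xs) \<otimes>\<^bsub>braid_group n\<^esub> ?s (Suc j)"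
    if D: "?D xs i" "?D xs j" and ij: "j = Suc i" for i j
  proof -
    \<comment> \<open>Three consecutive entries descend in height. Starting with either swap, the
      outer two become neighbours, and three descents reverse the triple; the two ways give the two
      sides of the braid relation.\<close>
    have low: "lower (xs ! Suc (Suc i)) (xs ! i)" using D ij lower_trans by blast
    have D': "?D (swap_at i xs) j" "?D (swap_at j xs) i"
      using D ij len low by (auto simp: nth_swap_at)
    have D'': "?D (swap_at j (swap_at i xs)) i" "?D (swap_at i (swap_at j xs)) j"
      using D ij len low by (auto simp: nth_swap_at)
    have sw: "swap_at i (swap_at j (swap_at i xs)) = swap_at j (swap_at i (swap_at j xs))"
      using D ij len by (intro nth_equalityI) (auto simp: nth_swap_at)
    have br: "?s (Suc i) \<otimes>\<^bsub>braid_group n\<^esub> (?s (Suc j) \<otimes>\<^bsub>braid_group n\<^esub> ?s (Suc i)) =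
        ?s (Suc j) \<otimes>\<^bsub>braid_group n\<^esub> (?s (Suc i) \<otimes>\<^bsub>braid_group n\<^esub> ?s (Suc j))"
      using braid_gen_braid[of "Suc i" n] D ij s by (simp add: m_assoc)
    show ?thesis
      unfolding IH[OF D(1) D'(1)] IH[OF D(2) D'(2)] IH2[OF D(1) D'(1) D''(1)]
        IH2[OF D(2) D'(2) D''(2)] sw
      using s D cl3[OF D(2) D'(2) D''(2)] by (simp add: m_assoc br)
  qed
  have eq: "braid_of (swap_at i xs) \<otimes>\<^bsub>braid_group n\<^esub> ?s (Suc i) =
      braid_of (swap_at j xs) \<otimes>\<^bsub>braid_group n\<^esub> ?s (Suc j)" if D: "?D xs i" "?D xs j" for i j
  proof -
    consider "i = j" | "j = Suc i" | "i = Suc j" | "i + 2 \<le> j" | "j + 2 \<le> i" by linarith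
    then show ?thesis
    proof cases
      case 1 then show ?thesis by simp
    next
      case 2 then show ?thesis by (rule adj[OF D])
    next
      case 3 then show ?thesis by (rule adj[OF D(2,1), symmetric])
    next
      case 4 then show ?thesis by (rule far[OF D])
    next
      case 5 then show ?thesis by (rule far[OF D(2,1), symmetric])
    qed
  qed
  show ?case
  proof (cases "\<exists>i. ?D xs i")
    case True
    define i where "i = (SOME i. ?D xs i)"
    have i: "?D xs i" using someI_ex[OF True] by (simp add: i_def)
    have "braid_of xs = braid_of (swap_at i xs) \<otimes>\<^bsub>braid_group n\<^esub> ?s (Suc i)"
      using True by (subst braid_of.simps) (simp add: len i_def Let_def)
    moreover have "braid_of xs \<in> carrier (braid_group n)"
      unfolding calculation using cl[OF i] s i by blast
    ultimately show ?thesis using eq[OF i] by metis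
  next
    case False
    then show ?thesis using braid_of_sorted[of xs] len by auto
  qed
qed

lemma braid_of_closed: "braid_of xs \<in> carrier (braid_group (length xs))"
  using braid_of_descent_closed by blast

lemma braid_of_descent:
  "Suc i < length xs \<Longrightarrow> lower (xs ! Suc i) (xs ! i) \<Longrightarrow>
    braid_of xs = braid_of (swap_at i xs) \<otimes>\<^bsub>braid_group (length xs)\<^esub> braid_gen (length xs) (Suc i)"
  using braid_of_descent_closed by blast

text \<open>Exactly one of the two lists has a descent at \<open>i\<close>, and the heights of the
  two points decide which; this fixes the exponent of the generator.\<close>

lemma braid_of_swap_at:
  assumes i: "Suc i < length xs" and ne: "xs ! i \<noteq> xs ! Suc i"
  shows "braid_of (swap_at i xs) = braid_of xs \<otimes>\<^bsub>braid_group (length xs)\<^esub>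
    (if lower (xs ! i) (xs ! Suc i) then braid_gen (length xs) (Suc i)
     else inv\<^bsub>braid_group (length xs)\<^esub> braid_gen (length xs) (Suc i))"
proof -
  interpret group "braid_group (length xs)" by (rule group_braid_group)
  have s: "braid_gen (length xs) (Suc i) \<in> carrier (braid_group (length xs))"
    using i by (intro braid_gen_closed) simp
  have b: "braid_of xs \<in> carrier (braid_group (length xs))"
    "braid_of (swap_at i xs) \<in> carrier (braid_group (length xs))"
    using braid_of_closed[of xs] braid_of_closed[of "swap_at i xs"] by simp_all
  show ?thesis
  proof (cases "lower (xs ! i) (xs ! Suc i)")
    case True
    then show ?thesis
      using braid_of_descent[of i "swap_at i xs"] i by (simp add: nth_swap_at swap_at_swap_at)
  next
    case False
    then show ?thesis
      using braid_of_descent[OF i] lower_total[OF ne] s b by (auto simp: m_assoc)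
  qed
qed

text \<open>Going from \<open>us\<close> to \<open>vs\<close> by swaps of inverted pairs, every swap
  contributes a generator determined by the position and an exponent determined by the heights. Two
  height functions that agree on the inverted pairs therefore give the same product. The index type
  provides labels that do not depend on the configuration.\<close>

lemma braid_of_quotient_cong:
  fixes a b :: "'i \<Rightarrow> complex"
  assumes "distinct us" "distinct vs" "set us = set vs"
    and inj: "inj_on a (set vs)" "inj_on b (set vs)"
    and inverted: "\<And>x y. before us x y \<Longrightarrow> before vs y x \<Longrightarrow> lower (a x) (a y) \<longleftrightarrow> lower (b x) (b y)"
  defines "n \<equiv> length vs"
  shows "inv\<^bsub>braid_group n\<^esub> braid_of (map a us) \<otimes>\<^bsub>braid_group n\<^esub> braid_of (map a vs) =
    inv\<^bsub>braid_group n\<^esub> braid_of (map b us) \<otimes>\<^bsub>braid_group n\<^esub> braid_of (map b vs)"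
  using assms(1-3) inverted
proof (induction us rule: swap_induct)
  case refl
  interpret group "braid_group n" by (rule group_braid_group)
  have "braid_of (map a vs) \<in> carrier (braid_group n)" "braid_of (map b vs) \<in> carrier (braid_group n)"
    using braid_of_closed[of "map a vs"] braid_of_closed[of "map b vs"] by (simp_all add: n_def)
  then show ?case by simp
next
  case (swap us i)
  interpret group "braid_group n" by (rule group_braid_group)
  have len: "length us = n"
    using swap assms(2) unfolding n_def by (metis distinct_card)
  have bef: "before us (us ! i) (us ! Suc i)" using swap unfolding before_def by blast
  have ne: "us ! i \<noteq> us ! Suc i" using swap by (simp add: nth_eq_iff_index_eq)
  have us: "us ! i \<in> set vs" "us ! Suc i \<in> set vs"
    using swap nth_mem[of i us] nth_mem[of "Suc i" us] by auto
  have IH: "inv\<^bsub>braid_group n\<^esub> braid_of (map a (swap_at i us)) \<otimes>\<^bsub>braid_group n\<^esub> braid_of (map a vs) =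
    inv\<^bsub>braid_group n\<^esub> braid_of (map b (swap_at i us)) \<otimes>\<^bsub>braid_group n\<^esub> braid_of (map b vs)"
  proof (rule swap.IH)
    fix x y assume xy: "before (swap_at i us) x y" "before vs y x"
    then have "before us x y"
      using before_swap_at[OF _ xy(1)] before_asym[OF assms(2)] swap by blast
    then show "lower (a x) (a y) = lower (b x) (b y)" using swap.prems xy by blast
  qed
  define t where "t = (if lower (a (us ! i)) (a (us ! Suc i)) then braid_gen n (Suc i)
      else inv\<^bsub>braid_group n\<^esub> braid_gen n (Suc i))"
  have t: "t \<in> carrier (braid_group n)"
  proof -
    have "braid_gen n (Suc i) \<in> carrier (braid_group n)"
      using swap.hyps(3) len by (intro braid_gen_closed) simp
    then show ?thesis by (simp add: t_def)
  qed
  have cl: "braid_of (map f ws) \<in> carrier (braid_group n)" if "length ws = n"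
    for f :: "'i \<Rightarrow> complex" and ws
    using braid_of_closed[of "map f ws"] that by simp
  \<comment> \<open>Applied with \<open>f = a\<close> and with \<open>f = b\<close>: the exchanged
    pair is inverted, so one factor \<open>t\<close> serves both.\<close>
  have step: "inv\<^bsub>braid_group n\<^esub> braid_of (map f us) \<otimes>\<^bsub>braid_group n\<^esub> braid_of (map f vs) =
      t \<otimes>\<^bsub>braid_group n\<^esub> (inv\<^bsub>braid_group n\<^esub> braid_of (map f (swap_at i us)) \<otimes>\<^bsub>braid_group n\<^esub> braid_of (map f vs))"
    if f: "inj_on f (set vs)" "lower (f (us ! i)) (f (us ! Suc i)) = lower (a (us ! i)) (a (us ! Suc i))" for f
  proof -
    have "f (us ! i) \<noteq> f (us ! Suc i)" using ne f(1) us by (metis inj_onD)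
    then have "braid_of (map f (swap_at i us)) = braid_of (map f us) \<otimes>\<^bsub>braid_group n\<^esub> t"
      using swap f(2) len braid_of_swap_at[of i "map f us"] by (simp add: map_swap_at t_def)
    then have "inv\<^bsub>braid_group n\<^esub> braid_of (map f (swap_at i us)) =
        inv\<^bsub>braid_group n\<^esub> t \<otimes>\<^bsub>braid_group n\<^esub> inv\<^bsub>braid_group n\<^esub> braid_of (map f us)"
      using t cl[of us f] len by (simp add: inv_mult_group)
    moreover have "t \<otimes>\<^bsub>braid_group n\<^esub> (inv\<^bsub>braid_group n\<^esub> t \<otimes>\<^bsub>braid_group n\<^esub> g) = g"
      if "g \<in> carrier (braid_group n)" for g
      using t that by (simp add: m_assoc[symmetric])
    moreover have "braid_of (map f vs) \<in> carrier (braid_group n)"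
      using cl[of vs f] by (simp add: n_def)
    ultimately show ?thesis
      using t cl[OF len, of f] by (simp add: m_assoc)
  qed
  show ?case
    using step[OF inj(1) HOL.refl] step[OF inj(2)] IH swap.prems[OF bef] swap by simp
qed


section \<open>The permutation action of braids\<close>

text \<open>The sign of a letter is dropped, since a generator and its inverse induce the same
  transposition. Positions are permuted, not entries, so the action commutes with maps of the
  entries. The first letter acts first, which makes this a right action; \<open>i - 1\<close>
  translates from generators to positions.\<close>

fun word_act :: "(nat \<times> bool) list \<Rightarrow> 'a list \<Rightarrow> 'a list" where
  "word_act [] xs = xs"
| "word_act ((i, s) # w) xs = word_act w (swap_at (i - 1) xs)"

lemma length_word_act [simp]: "length (word_act w xs) = length xs"
  by (induction w xs rule: word_act.induct) auto

lemma word_act_append: "word_act (u @ v) xs = word_act v (word_act u xs)"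
  by (induction u xs rule: word_act.induct) auto

lemma map_word_act:
  "w \<in> braid_words (length xs) \<Longrightarrow> map f (word_act w xs) = word_act w (map f xs)"
  by (induction w xs rule: word_act.induct) (auto simp: braid_words_def map_swap_at)

lemma word_act_cong: "braid_eq n u v \<Longrightarrow> length xs = n \<Longrightarrow> word_act u xs = word_act v xs"
proof (induction arbitrary: xs rule: braid_eq.induct)
  case (cancel i s)
  then show ?case by (simp add: swap_at_swap_at)
next
  case (far_commute i j)
  then show ?case by (intro nth_equalityI) (auto simp: nth_swap_at)
next
  case (braid i)
  then show ?case by (intro nth_equalityI) (auto simp: nth_swap_at)
qed (simp_all add: word_act_append)

lemma set_word_act: "w \<in> braid_words (length xs) \<Longrightarrow> set (word_act w xs) = set xs"
  by (induction w xs rule: word_act.induct) (auto simp: braid_words_def)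

definition braid_act :: "(nat \<times> bool) list set \<Rightarrow> 'a list \<Rightarrow> 'a list" where
  "braid_act g xs = word_act (SOME u. u \<in> g) xs"

lemma braid_act_class:
  assumes "u \<in> braid_words n" "length xs = n"
  shows "braid_act (braid_class n u) xs = word_act u xs"
proof -
  have "u \<in> braid_class n u" using assms(1) by (auto simp: braid_rel_def intro: braid_eq.refl)
  then have "(SOME v. v \<in> braid_class n u) \<in> braid_class n u" by (rule someI[of "\<lambda>v. v \<in> braid_class n u"])
  then have "braid_eq n u (SOME v. v \<in> braid_class n u)" by (simp add: braid_rel_def)
  from word_act_cong[OF this assms(2)] show ?thesis by (simp add: braid_act_def)
qed

lemma braid_class_cases:
  assumes "g \<in> carrier (braid_group n)"
  obtains u where "u \<in> braid_words n" "g = braid_class n u"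
  using assms by (auto simp: braid_group_def quotient_def)

lemma length_braid_act [simp]: "length (braid_act g xs) = length xs"
  by (simp add: braid_act_def)

lemma braid_act_mult:
  assumes "g \<in> carrier (braid_group n)" "h \<in> carrier (braid_group n)" "length xs = n"
  shows "braid_act (g \<otimes>\<^bsub>braid_group n\<^esub> h) xs = braid_act h (braid_act g xs)"
proof -
  obtain u v where uv: "u \<in> braid_words n" "g = braid_class n u" "v \<in> braid_words n" "h = braid_class n v"
    using assms by (metis braid_class_cases)
  then have "u @ v \<in> braid_words n" by (auto simp: braid_words_def)
  then show ?thesis
    using uv assms(3) by (simp add: braid_mult_class braid_act_class word_act_append)
qed

lemma braid_act_one: "length xs = n \<Longrightarrow> braid_act \<one>\<^bsub>braid_group n\<^esub> xs = xs"
  unfolding one_braid_group by (subst braid_act_class) (auto simp: braid_words_def)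

lemma braid_act_inv:
  assumes "g \<in> carrier (braid_group n)" "length xs = n"
  shows "braid_act (inv\<^bsub>braid_group n\<^esub> g) (braid_act g xs) = xs"
proof -
  interpret group "braid_group n" by (rule group_braid_group)
  show ?thesis
    using braid_act_mult[of g n "inv\<^bsub>braid_group n\<^esub> g" xs] assms by (simp add: braid_act_one)
qed

lemma braid_act_gen:
  "Suc i < n \<Longrightarrow> length xs = n \<Longrightarrow> braid_act (braid_gen n (Suc i)) xs = swap_at i xs"
  unfolding braid_gen_def by (subst braid_act_class) (auto simp: braid_words_def)

lemma map_braid_act:
  assumes "g \<in> carrier (braid_group n)" "length xs = n"
  shows "map f (braid_act g xs) = braid_act g (map f xs)"
  using assms by (auto elim!: braid_class_cases simp: braid_act_class map_word_act)

lemma set_braid_act: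
  assumes "g \<in> carrier (braid_group n)" "length xs = n"
  shows "set (braid_act g xs) = set xs"
  using assms by (auto elim!: braid_class_cases simp: braid_act_class set_word_act)

text \<open>\<open>braid_of\<close> is a section of the map from braids to permutations: undoing a
  descent removes one generator from the braid and one swap from the list. The enumeration by height
  is the common starting point for all enumerations of a set.\<close>

lemma braid_act_braid_of:
  assumes "sorted_wrt lower zs" "set xs = set zs" "distinct xs"
  shows "braid_act (braid_of xs) zs = xs"
  using assms(2,3)
proof (induction "card (inversions lower xs)" arbitrary: xs rule: less_induct)
  case less
  define n where "n = length xs"
  interpret group "braid_group n" by (rule group_braid_group)
  have "distinct zs"
    using assms(1) lower_asym by (induction zs) auto
  then have len: "length zs = n" using less.prems unfolding n_def by (metis distinct_card)
  show ?case
  proof (cases "\<exists>i. Suc i < length xs \<and> lower (xs ! Suc i) (xs ! i)")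
    case True
    then obtain i where i: "Suc i < length xs" "lower (xs ! Suc i) (xs ! i)" by blast
    have "card (inversions lower (swap_at i xs)) < card (inversions lower xs)"
      using i lower_asym[OF i(2)] by (intro card_inversions_swap_at)
    then have "braid_act (braid_of (swap_at i xs)) zs = swap_at i xs" using less i by simp
    moreover have "braid_of (swap_at i xs) \<in> carrier (braid_group n)"
      using braid_of_closed[of "swap_at i xs"] by (simp add: n_def)
    ultimately show ?thesis
      using i len braid_of_descent[OF i]
      by (simp add: braid_act_mult[where n = n] braid_gen_closed braid_act_gen swap_at_swap_at flip: n_def)
  next
    case False
    have "lower (xs ! i) (xs ! Suc i)" if "Suc i < length xs" for i
      using that False less.prems(2) lower_total[of "xs ! i" "xs ! Suc i"]
      by (auto simp: nth_eq_iff_index_eq)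
    moreover have "transp lower" using lower_trans by (auto simp: transp_def)
    ultimately have "sorted_wrt lower xs" by (simp add: sorted_wrt_iff_nth_Suc_transp)
    from sorted_wrt_unique[OF this assms(1) less.prems(1) lower_asym] have "xs = zs" .
    then show ?thesis using braid_of_sorted[of xs] False by (auto simp: braid_act_one)
  qed
qed


section \<open>The braid cocycle of configurations\<close>

text \<open>Ties in the real part are broken so that every finite set has exactly one left-to-right
  list. The list can jump when points pass through a common vertical line.\<close>

definition left :: "complex \<Rightarrow> complex \<Rightarrow> bool" where
  "left z w \<longleftrightarrow> Re z < Re w \<or> Re z = Re w \<and> Im z < Im w"

lemma left_asym: "left z w \<Longrightarrow> \<not> left w z"
  and left_trans: "left z w \<Longrightarrow> left w v \<Longrightarrow> left z v"
  and left_total: "z \<noteq> w \<Longrightarrow> left z w \<or> left w z"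
  by (auto simp: left_def complex_eq_iff)

lemma sorted_wrt_exists:
  assumes "finite S" and trans: "\<And>x y z. R x y \<Longrightarrow> R y z \<Longrightarrow> R x z"
    and total: "\<And>x y. x \<noteq> y \<Longrightarrow> R x y \<or> R y x"
  shows "\<exists>xs. sorted_wrt R xs \<and> set xs = S"
  using assms(1)
proof (induction S rule: finite_induct)
  case (insert x S)
  then obtain xs where xs: "sorted_wrt R xs" "set xs = S" by blast
  let ?ys = "filter (\<lambda>y. R y x) xs @ x # filter (\<lambda>y. R x y \<and> \<not> R y x) xs"
  have "sorted_wrt R ?ys"
    using xs trans by (auto simp: sorted_wrt_append sorted_wrt_filter)
  moreover have "set ?ys = insert x S"
    using xs total insert.hyps by auto
  ultimately show ?case by blast
qed simp

lemma sorted_wrt_distinct: "sorted_wrt R xs \<Longrightarrow> (\<And>x. \<not> R x x) \<Longrightarrow> distinct xs"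
  by (induction xs) auto

definition left_list :: "complex set \<Rightarrow> complex list" where
  "left_list S = (THE xs. sorted_wrt left xs \<and> set xs = S)"

lemma left_list:
  assumes "finite S"
  shows "sorted_wrt left (left_list S)" "set (left_list S) = S" "distinct (left_list S)"
    "length (left_list S) = card S"
proof -
  obtain xs where xs: "sorted_wrt left xs \<and> set xs = S"
    using sorted_wrt_exists[OF assms, of left] left_trans left_total by blast
  moreover have "ys = xs" if "sorted_wrt left ys \<and> set ys = S" for ys
    using sorted_wrt_unique[of left ys xs] xs that left_asym by blast
  ultimately have *: "sorted_wrt left (left_list S) \<and> set (left_list S) = S"
    unfolding left_list_def by (rule theI)
  then show "sorted_wrt left (left_list S)" "set (left_list S) = S" by auto
  then show "distinct (left_list S)" using sorted_wrt_distinct[of left] left_asym by blast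
  then show "length (left_list S) = card S" using * distinct_card by metis
qed

text \<open>Matches the points of a nearby configuration with those of \<open>S\<close>. For distant
  configurations the value is an arbitrary choice among closest points, so that the cocycle is
  defined for all pairs.\<close>

definition nearest :: "complex set \<Rightarrow> complex \<Rightarrow> complex" where
  "nearest S w = (SOME z. z \<in> S \<and> (\<forall>z'\<in>S. dist w z \<le> dist w z'))"

lemma nearest_eqI:
  assumes "z \<in> S" "\<And>z'. z' \<in> S \<Longrightarrow> z' \<noteq> z \<Longrightarrow> dist w z < dist w z'"
  shows "nearest S w = z"
  unfolding nearest_def
proof (rule some_equality)
  show "z \<in> S \<and> (\<forall>z'\<in>S. dist w z \<le> dist w z')" using assms by force
  show "y = z" if "y \<in> S \<and> (\<forall>z'\<in>S. dist w y \<le> dist w z')" for y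
    using that assms by force
qed

text \<open>
  The braid of the motion that takes the points of \<open>S\<close> to the nearby points of \<open>T\<close>, each strand
  at a constant height: both lists below are enumerations of \<open>S\<close>, from left to right before and
  after the motion.
\<close>

definition conf_cocycle :: "nat \<Rightarrow> complex set \<Rightarrow> complex set \<Rightarrow> (nat \<times> bool) list set" where
  "conf_cocycle n S T = inv\<^bsub>braid_group n\<^esub> braid_of (left_list S) \<otimes>\<^bsub>braid_group n\<^esub>
    braid_of (map (nearest S) (left_list T))"

lemma conf_cocycle_closed:
  assumes "finite S" "card S = n" "finite T" "card T = n"
  shows "conf_cocycle n S T \<in> carrier (braid_group n)"
proof -
  interpret group "braid_group n" by (rule group_braid_group)
  show ?thesis
    unfolding conf_cocycle_def
    using braid_of_closed[of "left_list S"] braid_of_closed[of "map (nearest S) (left_list T)"]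
      left_list[OF assms(1)] left_list[OF assms(3)] assms by simp
qed

text \<open>The factor 16 leaves ample room: in nearby configurations points with different labels
  stay more than 14\<eta> apart, two points that change sides keep a vertical distance above
  10\<eta>, and the vertical difference of two points varies by less than 4\<eta>.\<close>

locale separated_points =
  fixes I :: "complex set" and \<eta> :: real
  assumes finite_I: "finite I"
    and separated: "\<And>z w. z \<in> I \<Longrightarrow> w \<in> I \<Longrightarrow> z \<noteq> w \<Longrightarrow> 16 * \<eta> \<le> dist z w"
begin

text \<open>\<open>I\<close> is a reference configuration. Nearby configurations are written as
  images of \<open>I\<close>, so that the points of \<open>I\<close> label the points of all of them
  at once.\<close>

definition close :: "(complex \<Rightarrow> complex) \<Rightarrow> bool" where
  "close a \<longleftrightarrow> (\<forall>z\<in>I. dist (a z) z < \<eta>)"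

lemma close_dist:
  assumes "close a" "close b" "z \<in> I"
  shows "dist (a z) (b z) < 2 * \<eta>"
  using assms dist_triangle2[of "a z" "b z" z] unfolding close_def by fastforce

lemma close_far:
  assumes "close a" "close b" "z \<in> I" "w \<in> I" "z \<noteq> w"
  shows "14 * \<eta> < dist (a z) (b w)"
proof -
  have "dist z w \<le> dist (a z) z + dist (a z) (b w) + dist (b w) w"
    using dist_triangle[of z w "a z"] dist_triangle[of "a z" w "b w"] by (simp add: dist_commute)
  then show ?thesis using assms separated[of z w] unfolding close_def by fastforce
qed

lemma close_eta_pos: "close a \<Longrightarrow> z \<in> I \<Longrightarrow> 0 < \<eta>"
  unfolding close_def using zero_le_dist le_less_trans by blast

lemma close_inj: "close a \<Longrightarrow> inj_on a I"
  using close_far[of a a] close_eta_pos by (fastforce simp: inj_on_def)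

lemma nearest_close:
  assumes "close a" "close b" "z \<in> I"
  shows "nearest (a ` I) (b z) = a z"
proof (rule nearest_eqI)
  fix z' assume "z' \<in> a ` I" "z' \<noteq> a z"
  then obtain w where w: "w \<in> I" "z' = a w" "w \<noteq> z" by blast
  have "dist (b z) (a z) < 2 * \<eta>" "14 * \<eta> < dist (b z) (a w)"
    using assms w close_dist close_far by auto
  then show "dist (b z) (a z) < dist (b z) z'"
    unfolding w(2) using close_eta_pos[OF assms(1,3)] by linarith
qed (use assms in simp)

definition labels :: "(complex \<Rightarrow> complex) \<Rightarrow> complex list" where
  "labels a = map (inv_into I a) (left_list (a ` I))"

lemma labels:
  assumes "close a"
  shows "map a (labels a) = left_list (a ` I)" "set (labels a) = I" "distinct (labels a)"
    "length (labels a) = card I"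
proof -
  have fin: "finite (a ` I)" using finite_I by simp
  note L = left_list[OF fin]
  have inj: "inj_on a I" by (rule close_inj[OF assms])
  show "map a (labels a) = left_list (a ` I)"
    unfolding labels_def map_map using L(2) by (intro map_idI) (simp add: f_inv_into_f)
  show s: "set (labels a) = I"
    unfolding labels_def set_map L(2) using inj by (force simp: image_iff)
  show "length (labels a) = card I"
    unfolding labels_def length_map L(4) using inj by (rule card_image)
  then show "distinct (labels a)" using s by (metis card_distinct)
qed

lemma map_nearest_labels:
  assumes "close a" "close b"
  shows "map (nearest (a ` I)) (left_list (b ` I)) = map a (labels b)"
  unfolding labels(1)[OF assms(2), symmetric] map_map
  using labels(2)[OF assms(2)] nearest_close[OF assms] by (intro map_cong) auto

lemma conf_cocycle_close:
  assumes "close a" "close b"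
  shows "conf_cocycle n (a ` I) (b ` I) =
    inv\<^bsub>braid_group n\<^esub> braid_of (map a (labels a)) \<otimes>\<^bsub>braid_group n\<^esub> braid_of (map a (labels b))"
  unfolding conf_cocycle_def map_nearest_labels[OF assms] labels(1)[OF assms(1)] by simp

lemma labels_before:
  assumes "close a" "before (labels a) x y"
  shows "left (a x) (a y)" "x \<in> I" "y \<in> I"
proof -
  have "sorted_wrt (\<lambda>x y. left (a x) (a y)) (labels a)"
    using left_list(1)[of "a ` I"] finite_I labels(1)[OF assms(1)] by (simp flip: sorted_wrt_map)
  then show "left (a x) (a y)"
    using assms(2) unfolding sorted_wrt_iff_nth_less before_def by blast
  show "x \<in> I" "y \<in> I"
    using assms(2) labels(2)[OF assms(1)] unfolding before_def by force+
qed

text \<open>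
  Two points that change sides are close in the horizontal direction at some moment, hence
  stay well separated vertically.
\<close>

lemma conf_cocycle_mult:
  assumes a: "close a" and b: "close b" and d: "close d" and n: "card I = n"
  shows "conf_cocycle n (a ` I) (b ` I) \<otimes>\<^bsub>braid_group n\<^esub> conf_cocycle n (b ` I) (d ` I) =
    conf_cocycle n (a ` I) (d ` I)"
proof -
  interpret group "braid_group n" by (rule group_braid_group)
  have cl: "braid_of (map f (labels g)) \<in> carrier (braid_group n)" if "close g" for f g
    using braid_of_closed[of "map f (labels g)"] labels(4)[OF that] n by simp
  \<comment> \<open>The heights are now read in the configuration of \<open>a\<close> instead of
    that of \<open>b\<close>. Once all factors use the same heights, the product telescopes.\<close>
  have "conf_cocycle n (b ` I) (d ` I) =
      inv\<^bsub>braid_group n\<^esub> braid_of (map a (labels b)) \<otimes>\<^bsub>braid_group n\<^esub> braid_of (map a (labels d))"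
  proof -
    have "lower (b x) (b y) = lower (a x) (a y)"
      if "before (labels b) x y" "before (labels d) y x" for x y
    proof -
      note lb = labels_before[OF b that(1)] and ld = labels_before[OF d that(2)]
      have ne: "x \<noteq> y" using lb left_asym by blast
      have pos: "\<eta> > 0" using close_eta_pos[OF a lb(2)] .
      have re: "\<bar>Re (b z) - Re (d z)\<bar> < 2 * \<eta>" and im: "\<bar>Im (a z) - Im (b z)\<bar> < 2 * \<eta>"
        if "z \<in> I" for z
        using close_dist[OF b d that] close_dist[OF a b that]
          abs_Re_le_cmod[of "b z - d z"] abs_Im_le_cmod[of "a z - b z"]
        by (simp_all add: dist_norm)
      \<comment> \<open>The difference of the real parts changes sign between \<open>b\<close> and
        \<open>d\<close> while each point moves by less than 2\<eta>. So in \<open>b\<close> it is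
        below 4\<eta>, and the distance of the two points must be mainly vertical.\<close>
      have "Re (b x) \<le> Re (b y)" "Re (d y) \<le> Re (d x)"
        using lb(1) ld(1) by (auto simp: left_def)
      then have "\<bar>Re (b x - b y)\<bar> < 4 * \<eta>" using re[OF lb(2)] re[OF lb(3)] by simp
      moreover have "14 * \<eta> < \<bar>Re (b x - b y)\<bar> + \<bar>Im (b x - b y)\<bar>"
        using close_far[OF b b lb(2,3) ne] cmod_le[of "b x - b y"] by (simp add: dist_norm)
      ultimately have "10 * \<eta> < \<bar>Im (b x) - Im (b y)\<bar>" by simp
      then show ?thesis
        using im[OF lb(2)] im[OF lb(3)] pos unfolding lower_def by linarith
    qed
    then show ?thesis
      unfolding conf_cocycle_close[OF b d]
      using braid_of_quotient_cong[of "labels b" "labels d" b a] labels[OF b] labels[OF d]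
        close_inj[OF a] close_inj[OF b] n by simp
  qed
  then show ?thesis
    unfolding conf_cocycle_close[OF a b] conf_cocycle_close[OF a d]
    using cl[OF a, of a] cl[OF b, of a] cl[OF d, of a] inv_solve_left by (simp add: m_assoc) (simp add: m_assoc[symmetric])
qed

text \<open>The inverse of the first braid leads from the left-to-right list back to the list
  \<open>zs\<close> sorted by height, and the second braid leads on to the order after the
  motion.\<close>

lemma braid_act_conf_cocycle:
  assumes a: "close a" and b: "close b" and n: "card I = n"
  shows "braid_act (conf_cocycle n (a ` I) (b ` I)) (left_list (a ` I)) =
    map (nearest (a ` I)) (left_list (b ` I))"
proof -
  interpret group "braid_group n" by (rule group_braid_group)
  obtain zs where zs: "sorted_wrt lower zs" "set zs = a ` I"
    using sorted_wrt_exists[of "a ` I" lower] finite_I lower_trans lower_total by blast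
  have "distinct zs" using sorted_wrt_distinct[OF zs(1)] lower_asym by blast
  then have len: "length zs = n"
    using zs(2) n card_image[OF close_inj[OF a]] by (metis distinct_card)
  have eq: "map (nearest (a ` I)) (left_list (b ` I)) = map a (labels b)"
    by (rule map_nearest_labels[OF a b])
  let ?g = "braid_of (left_list (a ` I))" and ?h = "braid_of (map a (labels b))"
  have lenL: "length (left_list (a ` I)) = n"
    using labels(4)[OF a] n by (simp flip: labels(1)[OF a])
  have cl: "?g \<in> carrier (braid_group n)" "?h \<in> carrier (braid_group n)"
    using braid_of_closed[of "left_list (a ` I)"] braid_of_closed[of "map a (labels b)"]
      lenL labels(4)[OF b] n by simp_all
  have g: "braid_act ?g zs = left_list (a ` I)"
    using left_list[of "a ` I"] finite_I zs by (intro braid_act_braid_of) auto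
  have h: "braid_act ?h zs = map a (labels b)"
    using zs labels[OF b] close_inj[OF a] by (intro braid_act_braid_of) (auto simp: distinct_map)
  have "braid_act (inv\<^bsub>braid_group n\<^esub> ?g) (left_list (a ` I)) = zs"
    using braid_act_inv[OF cl(1) len] g by simp
  then show ?thesis
    unfolding conf_cocycle_def eq using cl h lenL by (simp add: braid_act_mult)
qed

end

lemma separated_points_exists:
  assumes "finite I" "0 < \<epsilon>"
  obtains \<eta> where "0 < \<eta>" "\<eta> \<le> \<epsilon>" "separated_points I \<eta>"
proof -
  \<comment> \<open>The extra element 16\<epsilon> bounds \<eta> by \<epsilon> and keeps
    \<open>D\<close> nonempty when \<open>I\<close> has fewer than two points.\<close>
  define D where "D = insert (16 * \<epsilon>) ((\<lambda>(z, w). dist z w) ` {(z, w) \<in> I \<times> I. z \<noteq> w})"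
  have fin: "finite D" unfolding D_def using assms(1) by (auto intro: finite_subset[of _ "I \<times> I"])
  have "0 < d" if "d \<in> D" for d using that assms(2) by (auto simp: D_def)
  then have "0 < Min D" using fin by (subst Min_gr_iff) (auto simp: D_def)
  moreover have "Min D \<le> 16 * \<epsilon>" using fin by (intro Min_le) (simp_all add: D_def)
  moreover have "Min D \<le> dist z w" if "z \<in> I" "w \<in> I" "z \<noteq> w" for z w
    using fin that by (intro Min_le) (force simp: D_def)+
  ultimately show thesis
    by (intro that[of "Min D / 16"]) (auto simp: separated_points_def assms(1))
qed


section \<open>Roots of Weierstrass polynomials\<close>

abbreviation roots :: "('a \<Rightarrow> complex poly) \<Rightarrow> 'a \<Rightarrow> complex set" where
  "roots f x \<equiv> {z. poly (f x) z = 0}"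

text \<open>Two monic polynomials of degree \<open>n\<close> that agree at \<open>n\<close> distinct
  points are equal.\<close>

lemma monic_poly_eq_prod_roots:
  fixes p :: "complex poly"
  assumes "degree p = n" "lead_coeff p = 1" "card {z. poly p z = 0} = n"
  shows "poly p u = (\<Prod>w | poly p w = 0. u - w)"
proof -
  let ?q = "\<Prod>w | poly p w = 0. [:- w, 1:]"
  have fin: "finite {z. poly p z = 0}" using assms(2) by (intro poly_roots_finite) auto
  have deg: "degree ?q = n" using assms(3) by (subst degree_prod_eq_sum_degree) auto
  have "lead_coeff ?q = 1" by (simp add: lead_coeff_prod)
  then have "p = ?q"
    using assms deg fin
    by (intro poly_eqI_degree_lead_coeff[where n = n and A = "{z. poly p z = 0}"])
      (auto simp: poly_prod)
  then have "poly p u = poly ?q u" by simp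
  then show ?thesis by (simp add: poly_prod)
qed

context
  fixes X :: "'a topology" and n and f
  assumes f: "weierstrass_polynomial X n f"
begin

lemma n_pos: "1 \<le> n" and card_roots: "x \<in> topspace X \<Longrightarrow> card (roots f x) = n"
  using f by (auto simp: weierstrass_polynomial_def)

lemma finite_roots: "x \<in> topspace X \<Longrightarrow> finite (roots f x)"
  using n_pos card_roots by (metis card.infinite not_one_le_zero)

lemma continuous_map_poly: "continuous_map X euclidean (\<lambda>x. poly (f x) u)"
proof -
  have "continuous_map X euclidean (\<lambda>x. coeff (f x) i * u ^ i)" for i
  proof -
    have "continuous_map X euclidean (\<lambda>x. coeff (f x) i)"
      using f by (simp add: weierstrass_polynomial_def)
    moreover have "continuous_map euclidean euclidean (\<lambda>c. c * u ^ i)"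
      by (simp add: continuous_on_mult_right)
    ultimately have "continuous_map X euclidean ((\<lambda>c. c * u ^ i) \<circ> (\<lambda>x. coeff (f x) i))"
      by (rule continuous_map_compose)
    then show ?thesis by (simp add: o_def)
  qed
  then have "continuous_map X euclidean (\<lambda>x. \<Sum>i\<le>n. coeff (f x) i * u ^ i)"
    by (intro continuous_map_sum) auto
  then show ?thesis
    by (rule continuous_map_eq) (use f in \<open>auto simp: weierstrass_polynomial_def poly_altdef\<close>)
qed

text \<open>The value of \<open>f y\<close> at \<open>z\<close> is the product of the differences
  between \<open>z\<close> and the roots of \<open>f y\<close>. If all of these roots were at
  distance at least \<epsilon>, it would have modulus at least \<open>\<epsilon> ^ n\<close>; but it
  depends continuously on \<open>y\<close> and vanishes at \<open>y = x\<close> when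
  \<open>z\<close> is a root of \<open>f x\<close>.\<close>

lemma roots_nearby:
  assumes x: "x \<in> topspace X" and e: "0 < \<epsilon>"
  obtains U where "openin X U" "x \<in> U" "\<And>y z. y \<in> U \<Longrightarrow> z \<in> roots f x \<Longrightarrow> \<exists>w\<in>roots f y. dist w z < \<epsilon>"
proof -
  define V where "V z = {y \<in> topspace X. poly (f y) z \<in> ball 0 (\<epsilon> ^ n)}" for z
  define U where "U = (\<Inter>z\<in>roots f x. V z)"
  have V: "openin X (V z)" for z
    unfolding V_def by (intro openin_continuous_map_preimage[OF continuous_map_poly]) simp
  have ne: "roots f x \<noteq> {}" using card_roots[OF x] n_pos by (metis card.empty not_one_le_zero)
  show thesis
  proof (rule that)
    show "openin X U" unfolding U_def using ne finite_roots[OF x] V by (intro openin_INT2) auto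
    show "x \<in> U" using x e by (auto simp: U_def V_def)
    fix y z assume y: "y \<in> U" and z: "z \<in> roots f x"
    have "y \<in> V z" using y z unfolding U_def by (rule INT_D)
    then have yX: "y \<in> topspace X" and small: "cmod (poly (f y) z) < \<epsilon> ^ n"
      by (simp_all add: V_def)
    show "\<exists>w\<in>roots f y. dist w z < \<epsilon>"
    proof (rule ccontr)
      assume "\<not> ?thesis"
      then have "\<epsilon> \<le> cmod (z - w)" if "w \<in> roots f y" for w
        using that by (force simp: dist_norm norm_minus_commute)
      then have "(\<Prod>w\<in>roots f y. \<epsilon>) \<le> (\<Prod>w\<in>roots f y. cmod (z - w))"
        using e by (intro prod_mono) auto
      also have "\<dots> = cmod (poly (f y) z)"
      proof -
        have "degree (f y) = n" "lead_coeff (f y) = 1"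
          using f yX by (auto simp: weierstrass_polynomial_def)
        then show ?thesis
          using monic_poly_eq_prod_roots[of "f y" n z] card_roots[OF yX] by (simp only: prod_norm)
      qed
      finally show False using small card_roots[OF yX] by simp
    qed
  qed
qed

text \<open>Near each root of \<open>f x\<close> some root of \<open>f y\<close> is chosen.
  Separation makes the choice injective, and as both root sets have \<open>n\<close> elements it is
  onto.\<close>

lemma roots_labelled:
  assumes x: "x \<in> topspace X" and e: "0 < \<eta>" and sep: "separated_points (roots f x) \<eta>"
  obtains U m where "openin X U" "x \<in> U"
    "\<And>y. y \<in> U \<Longrightarrow> m y ` roots f x = roots f y \<and> separated_points.close (roots f x) \<eta> (m y)"
proof -
  interpret separated_points "roots f x" \<eta> by (rule sep)
  obtain U where U: "openin X U" "x \<in> U"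
    "\<And>y z. y \<in> U \<Longrightarrow> z \<in> roots f x \<Longrightarrow> \<exists>w\<in>roots f y. dist w z < \<eta>"
    using roots_nearby[OF x e] by metis
  define m where "m y z = (SOME w. w \<in> roots f y \<and> dist w z < \<eta>)" for y z
  have m: "m y z \<in> roots f y \<and> dist (m y z) z < \<eta>" if "y \<in> U" "z \<in> roots f x" for y z
    unfolding m_def using U(3)[OF that] by (intro someI_ex[of "\<lambda>w. w \<in> roots f y \<and> dist w z < \<eta>"]) blast
  show thesis
  proof (rule that[OF U(1,2)])
    fix y assume y: "y \<in> U"
    then have yX: "y \<in> topspace X" using U(1) openin_subset by blast
    have c: "close (m y)" unfolding close_def using m y by blast
    moreover have "m y ` roots f x = roots f y"
    proof (rule card_subset_eq[OF finite_roots[OF yX]])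
      show "m y ` roots f x \<subseteq> roots f y" using m y by blast
      show "card (m y ` roots f x) = card (roots f y)"
        using card_image[OF close_inj[OF c]] card_roots x yX by simp
    qed
    ultimately show "m y ` roots f x = roots f y \<and> close (m y)" by blast
  qed
qed

text \<open>The roots over \<open>x\<close> serve as the reference configuration: for all points
  near \<open>x\<close> the root sets are images of it under close maps, where the cocycle is
  multiplicative.\<close>

lemma local_cocycle_roots:
  "local_cocycle (braid_group n) X (\<lambda>x y. conf_cocycle n (roots f x) (roots f y))"
proof -
  interpret group "braid_group n" by (rule group_braid_group)
  show ?thesis
  proof
    show "conf_cocycle n (roots f x) (roots f y) \<in> carrier (braid_group n)"
      if "x \<in> topspace X" "y \<in> topspace X" for x y
      using that finite_roots card_roots by (intro conf_cocycle_closed)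
    fix x assume x: "x \<in> topspace X"
    obtain \<eta> where \<eta>: "0 < \<eta>" "separated_points (roots f x) \<eta>"
      using separated_points_exists[OF finite_roots[OF x] zero_less_one] by metis
    interpret S: separated_points "roots f x" \<eta> by (rule \<eta>)
    obtain U m where U: "openin X U" "x \<in> U"
      "\<And>y. y \<in> U \<Longrightarrow> m y ` roots f x = roots f y \<and> S.close (m y)"
      using roots_labelled[OF x \<eta>] by metis
    have "conf_cocycle n (roots f u) (roots f v) \<otimes>\<^bsub>braid_group n\<^esub> conf_cocycle n (roots f v) (roots f w) =
        conf_cocycle n (roots f u) (roots f w)" if "u \<in> U" "v \<in> U" "w \<in> U" for u v w
      using S.conf_cocycle_mult[of "m u" "m v" "m w" n] U(3) that card_roots[OF x] by simp
    then show "\<exists>U. openin X U \<and> x \<in> U \<and> (\<forall>u\<in>U. \<forall>v\<in>U. \<forall>w\<in>U.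
        conf_cocycle n (roots f u) (roots f v) \<otimes>\<^bsub>braid_group n\<^esub> conf_cocycle n (roots f v) (roots f w) =
        conf_cocycle n (roots f u) (roots f w))"
      using U by blast
  qed
qed

lemma braid_free_imp_splits:
  assumes pc: "path_connected_space X" and lpc: "locally_path_connected_space X"
    and bf: "braid_free_space X" and ne: "topspace X \<noteq> {}"
  shows "splits_in X id n f"
proof -
  obtain x0 where x0: "x0 \<in> topspace X" using ne by blast
  let ?c = "\<lambda>x y. conf_cocycle n (roots f x) (roots f y)"
  interpret local_cocycle "braid_group n" X ?c by (rule local_cocycle_roots)
  have triv: "\<forall>A\<in>carrier (fundamental_group X x0). h A = \<one>\<^bsub>braid_group n\<^esub>"
    if "h \<in> hom (fundamental_group X x0) (braid_group n)" for h
    using bf x0 n_pos that unfolding braid_free_space_def braid_free_def by blast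
  obtain \<Psi> where \<Psi>: "\<Psi> ` topspace X \<subseteq> carrier (braid_group n)"
    "\<And>y. y \<in> topspace X \<Longrightarrow> \<exists>V. openin X V \<and> y \<in> V \<and> (\<forall>z\<in>V. \<Psi> y \<otimes>\<^bsub>braid_group n\<^esub> ?c y z = \<Psi> z)"
    by (rule trivial_monodromy_imp_coboundary[OF pc lpc x0 triv]) blast+
  have \<Psi>cl: "\<Psi> y \<in> carrier (braid_group n)" if "y \<in> topspace X" for y using \<Psi>(1) that by blast
  \<comment> \<open>The left-to-right list, reordered so as to cancel its jumps. The function for
    the \<open>k\<close>-th entry will be one of the global roots.\<close>
  define L where "L y = braid_act (inv\<^bsub>braid_group n\<^esub> \<Psi> y) (left_list (roots f y))" for y
  have len: "length (left_list (roots f y)) = n" if "y \<in> topspace X" for y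
    using left_list(4)[OF finite_roots[OF that]] card_roots[OF that] by simp
  have lenL: "length (L y) = n" if "y \<in> topspace X" for y
    using len[OF that] by (simp add: L_def)
  have setL: "set (L y) = roots f y" if "y \<in> topspace X" for y
    using set_braid_act[OF _ len[OF that], of "inv\<^bsub>braid_group n\<^esub> \<Psi> y"] \<Psi>cl[OF that]
      left_list(2)[OF finite_roots[OF that]] by (simp add: L_def)
  have cont: "continuous_map X euclidean (\<lambda>y. L y ! k)" if k: "k < n" for k
  proof -
    have "\<exists>W. openin X W \<and> y \<in> W \<and> (\<forall>z\<in>W. L z ! k \<in> ball (L y ! k) \<epsilon>)"
      if y: "y \<in> topspace X" and e: "0 < \<epsilon>" for y \<epsilon>
    proof -
      obtain \<eta> where \<eta>: "0 < \<eta>" "\<eta> \<le> \<epsilon>" "separated_points (roots f y) \<eta>"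
        using separated_points_exists[OF finite_roots[OF y] e] by metis
      interpret S: separated_points "roots f y" \<eta> by (rule \<eta>)
      obtain U m where U: "openin X U" "y \<in> U"
        "\<And>z. z \<in> U \<Longrightarrow> m z ` roots f y = roots f z \<and> S.close (m z)"
        using roots_labelled[OF y \<eta>(1,3)] by metis
      obtain V where V: "openin X V" "y \<in> V" "\<And>z. z \<in> V \<Longrightarrow> \<Psi> y \<otimes>\<^bsub>braid_group n\<^esub> ?c y z = \<Psi> z"
        using \<Psi>(2)[OF y] by blast
      \<comment> \<open>The configuration over \<open>y\<close> is the reference itself, labelled by
        the identity.\<close>
      have id: "S.close id" using \<eta>(1) by (simp add: S.close_def)
      have "L z ! k \<in> ball (L y ! k) \<epsilon>" if z: "z \<in> U \<inter> V" for z
      proof -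
        have zX: "z \<in> topspace X" using z U(1) openin_subset by blast
        have mz: "S.close (m z)" "m z ` roots f y = roots f z" using z U(3) by auto
        have act: "braid_act (?c y z) (left_list (roots f y)) = map (nearest (roots f y)) (left_list (roots f z))"
          using S.braid_act_conf_cocycle[OF id mz(1) card_roots[OF y]] mz(2) by simp
        have cl: "?c y z \<in> carrier (braid_group n)" by (rule c_closed[OF y zX])
        have inv: "inv\<^bsub>braid_group n\<^esub> \<Psi> z = inv\<^bsub>braid_group n\<^esub> ?c y z \<otimes>\<^bsub>braid_group n\<^esub> inv\<^bsub>braid_group n\<^esub> \<Psi> y"
          using V(3)[of z] z cl \<Psi>cl[OF y] by (simp add: inv_mult_group flip: V(3))
        \<comment> \<open>Reordering permutes positions, hence commutes with \<open>nearest\<close>.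
          By the right action, the factor of the inverse of \<open>\<Psi> z\<close> that acts first
          is the inverse of the cocycle, and it undoes the jump of the list between \<open>y\<close>
          and \<open>z\<close>.\<close>
        have "map (nearest (roots f y)) (L z) =
            braid_act (inv\<^bsub>braid_group n\<^esub> \<Psi> z) (braid_act (?c y z) (left_list (roots f y)))"
          unfolding L_def act using \<Psi>cl[OF zX] len[OF zX] by (intro map_braid_act) auto
        also have "\<dots> = L y"
          unfolding inv L_def using cl \<Psi>cl[OF y] len[OF y] by (simp add: braid_act_mult braid_act_inv)
        finally have "map (nearest (roots f y)) (L z) = L y" .
        then have near: "nearest (roots f y) (L z ! k) = L y ! k"
          using k lenL[OF zX] by (metis nth_map)
        have "L z ! k \<in> m z ` roots f y"
          unfolding mz(2) setL[OF zX, symmetric] using k lenL[OF zX] by (intro nth_mem) simp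
        then obtain u where u: "u \<in> roots f y" "L z ! k = m z u" by blast
        then have "L y ! k = u" using near S.nearest_close[OF id mz(1) u(1)] by simp
        then show ?thesis using u mz(1) \<eta>(2) by (auto simp: S.close_def dist_commute)
      qed
      then show ?thesis using U V by (intro exI[of _ "U \<inter> V"]) auto
    qed
    then show ?thesis using Met_TC.continuous_map_to_metric[of X "\<lambda>y. L y ! k"] by simp
  qed
  define r where "r k = restrict (\<lambda>y. L y ! k) (topspace X)" for k
  have "inj_on r {..<n}"
  proof (rule inj_onI)
    fix j k assume jk: "j \<in> {..<n}" "k \<in> {..<n}" "r j = r k"
    \<comment> \<open>Equal functions have equal values at \<open>x0\<close>, so distinct entries
      over this one point separate all \<open>n\<close> of them.\<close>
    have "distinct (L x0)"
      using setL[OF x0] lenL[OF x0] card_roots[OF x0] by (metis card_distinct)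
    moreover have "L x0 ! j = L x0 ! k" using fun_cong[OF jk(3), of x0] x0 by (simp add: r_def)
    ultimately show "j = k" using jk lenL[OF x0] by (simp add: nth_eq_iff_index_eq)
  qed
  moreover have "r ` {..<n} \<subseteq> cfunctions X"
    unfolding cfunctions_def r_def using cont by (auto intro: continuous_map_eq)
  moreover have "poly (f y) (L y ! k) = 0" if "k < n" "y \<in> topspace X" for k y
    using nth_mem[of k "L y"] that setL lenL by auto
  ultimately show ?thesis
    unfolding splits_in_def by (intro exI[of _ "r ` {..<n}"] conjI) (auto simp: card_image, simp add: r_def)
qed

end


section \<open>Coverings in which all Weierstrass polynomials split\<close>

text \<open>For \<open>pointed_covering_map\<close>, which asks for an extensional covering map:
  restriction to the carrier must preserve coverings.\<close>

lemma covering_map_cong: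
  assumes p: "covering_map Y X p" and eq: "\<And>y. y \<in> topspace Y \<Longrightarrow> p y = p' y"
  shows "covering_map Y X p'"
  unfolding covering_map_def
proof (intro conjI ballI)
  have "continuous_map Y X p" using p by (simp add: covering_map_def)
  then show "continuous_map Y X p'" by (rule continuous_map_eq) (rule eq)
  show "p' ` topspace Y = topspace X"
    using p image_cong[OF HOL.refl eq, of "topspace Y"] by (simp add: covering_map_def)
  fix x assume "x \<in> topspace X"
  then obtain U \<V> where U: "openin X U" "x \<in> U" and V: "\<Union>\<V> = {y \<in> topspace Y. p y \<in> U}"
    "\<And>V. V \<in> \<V> \<Longrightarrow> openin Y V" "pairwise disjnt \<V>"
    "\<And>V. V \<in> \<V> \<Longrightarrow> homeomorphic_map (subtopology Y V) (subtopology X U) p"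
    by (rule covering_mapE[OF p]) blast
  have "\<Union>\<V> = {y \<in> topspace Y. p' y \<in> U}" using V(1) eq by auto
  moreover have "homeomorphic_map (subtopology Y V) (subtopology X U) p'" if "V \<in> \<V>" for V
    using V(4)[OF that] by (rule homeomorphic_map_eq) (simp add: eq)
  ultimately show "\<exists>U. openin X U \<and> x \<in> U \<and> (\<exists>\<V>. \<Union>\<V> = {y \<in> topspace Y. p' y \<in> U} \<and>
      (\<forall>V\<in>\<V>. openin Y V) \<and> pairwise disjnt \<V> \<and>
      (\<forall>V\<in>\<V>. homeomorphic_map (subtopology Y V) (subtopology X U) p'))"
    using U V(2,3) by (intro exI[of _ U] conjI exI[of _ \<V>]) auto
qed

lemma covering_map_postcompose_homeomorphism:
  assumes p: "covering_map Y X p" and h: "homeomorphic_map X Z h"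
  shows "covering_map Y Z (h \<circ> p)"
  unfolding covering_map_def
proof (intro conjI ballI)
  show "continuous_map Y Z (h \<circ> p)"
    using p homeomorphic_imp_continuous_map[OF h]
    by (auto simp: covering_map_def intro: continuous_map_compose)
  have pX: "p ` topspace Y = topspace X" using p by (simp add: covering_map_def)
  have hX: "h ` topspace X = topspace Z" using h by (rule homeomorphic_imp_surjective_map)
  have inj: "inj_on h (topspace X)" using h by (rule homeomorphic_imp_injective_map)
  show "(h \<circ> p) ` topspace Y = topspace Z" by (simp only: image_comp[symmetric] pX hX)
  fix z assume "z \<in> topspace Z"
  then obtain x where x: "x \<in> topspace X" "z = h x" using hX by blast
  obtain U \<V> where U: "openin X U" "x \<in> U" and V: "\<Union>\<V> = {y \<in> topspace Y. p y \<in> U}"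
    "\<And>V. V \<in> \<V> \<Longrightarrow> openin Y V" "pairwise disjnt \<V>"
    "\<And>V. V \<in> \<V> \<Longrightarrow> homeomorphic_map (subtopology Y V) (subtopology X U) p"
    by (rule covering_mapE[OF p x(1)]) blast
  have UX: "U \<subseteq> topspace X" using U openin_subset by blast
  have "openin Z (h ` U)" using h U(1) UX homeomorphic_map_openness_eq by blast
  moreover have "h y \<in> h ` U \<longleftrightarrow> y \<in> U" if "y \<in> topspace X" for y
    using that inj UX by (meson inj_on_image_mem_iff)
  then have "\<Union>\<V> = {y \<in> topspace Y. (h \<circ> p) y \<in> h ` U}" unfolding V(1) using pX by auto
  moreover have "homeomorphic_map (subtopology Y V) (subtopology Z (h ` U)) (h \<circ> p)" if "V \<in> \<V>" for V
  proof (rule homeomorphic_map_compose[OF V(4)[OF that]])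
    show "homeomorphic_map (subtopology X U) (subtopology Z (h ` U)) h"
      using UX hX by (intro homeomorphic_map_subtopologies[OF h]) auto
  qed
  ultimately show "\<exists>W. openin Z W \<and> z \<in> W \<and> (\<exists>\<V>. \<Union>\<V> = {y \<in> topspace Y. (h \<circ> p) y \<in> W} \<and>
      (\<forall>V\<in>\<V>. openin Y V) \<and> pairwise disjnt \<V> \<and>
      (\<forall>V\<in>\<V>. homeomorphic_map (subtopology Y V) (subtopology Z W) (h \<circ> p)))"
    using U x V(2,3) by (intro exI[of _ "h ` U"] conjI exI[of _ \<V>]) auto
qed

lemma covering_map_id: "covering_map X X id"
  unfolding covering_map_def
  by (auto intro!: exI[of _ "topspace X"] exI[of _ "{topspace X}"])

text \<open>Every covering factors through the identity covering by its own projection, so the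
  identity is minimal as soon as \<open>f\<close> splits in it. \<open>Z\<close> is a copy of
  \<open>X\<close> on the required carrier type.\<close>

lemma splitting_covering_if_splits:
  fixes X :: "'a topology"
  assumes pc: "path_connected_space X" and sp: "splits_in X id n f"
  shows "\<exists>(E :: (real \<Rightarrow> 'a) set topology) q. splitting_covering X n f E q"
proof -
  obtain Z :: "(real \<Rightarrow> 'a) set topology" and h k where hk: "homeomorphic_maps X Z h k"
    using path_connected_covering_transfer[OF pc covering_map_id] by blast
  then have h: "homeomorphic_map X Z h" and k: "homeomorphic_map Z X k"
    and kh: "\<And>x. x \<in> topspace X \<Longrightarrow> k (h x) = x"
    by (auto simp: homeomorphic_maps_map)
  have "splitting_covering X n f Z (id \<circ> k)"
    unfolding splitting_covering_def
  proof (intro conjI allI impI)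
    show "path_connected_space Z"
      using pc h homeomorphic_path_connected_space homeomorphic_map_imp_homeomorphic_space by blast
    show "covering_map Z X (id \<circ> k)"
      by (rule covering_map_precompose_homeomorphism[OF covering_map_id k])
    show "splits_in Z (id \<circ> k) n f"
      using k by (intro splits_in_precompose[OF sp] homeomorphic_imp_continuous_map
          homeomorphic_imp_surjective_map)
    fix Y :: "(real \<Rightarrow> 'a) set topology" and p
    assume "path_connected_space Y \<and> covering_map Y X p \<and> splits_in Y p n f"
    then have p: "covering_map Y X p" by blast
    then have "p y \<in> topspace X" if "y \<in> topspace Y" for y using that by (auto simp: covering_map_def)
    then have "covering_map_over Y p Z (id \<circ> k) (h \<circ> p)"
      unfolding covering_map_over_def using covering_map_postcompose_homeomorphism[OF p h] kh by simp
    then show "\<exists>\<phi>. covering_map_over Y p Z (id \<circ> k) \<phi>" by blast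
  qed
  then show ?thesis by blast
qed

text \<open>Minimality, tested on the identity covering, yields a covering map from \<open>X\<close>
  to \<open>E\<close> that is a section of \<open>q\<close>. Being onto, it is a two-sided
  inverse.\<close>

lemma splitting_covering_homeomorphism:
  assumes pc: "path_connected_space X" and sp: "splits_in X id n f"
    and E: "splitting_covering X n f E q"
  shows "homeomorphic_map E X q"
proof -
  obtain \<phi> where \<phi>: "covering_map X E \<phi>" "\<And>x. x \<in> topspace X \<Longrightarrow> q (\<phi> x) = x"
    using splitting_covering_minimal[OF E pc covering_map_id sp] by (auto simp: covering_map_over_def)
  have "\<phi> (q y) = y" if "y \<in> topspace E" for y
  proof -
    have "y \<in> \<phi> ` topspace X" using that \<phi>(1) by (simp add: covering_map_def)
    then show ?thesis using \<phi>(2) by auto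
  qed
  moreover have "covering_map E X q" using E by (simp add: splitting_covering_def)
  ultimately have "homeomorphic_maps E X q \<phi>"
    using \<phi> by (simp add: homeomorphic_maps_def covering_map_def)
  then show ?thesis by (auto simp: homeomorphic_maps_map)
qed


section \<open>Triviality of the Galois group\<close>

lemma (in group) trivial_group_one: "trivial_group (G\<lparr>carrier := {\<one>}\<rparr>)"
  using subgroup.subgroup_is_group[OF triv_subgroup is_group] by (simp add: trivial_group_def)

lemma carrier_Deck_injective:
  assumes "inj_on p (topspace Y)"
  shows "carrier (Deck Y p) = {\<lambda>y\<in>topspace Y. y}"
proof -
  have "\<sigma> = (\<lambda>y\<in>topspace Y. y)"
    if \<sigma>: "\<sigma> \<in> Bij (topspace Y)" "\<forall>y\<in>topspace Y. p (\<sigma> y) = p y" for \<sigma>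
  proof (rule extensionalityI)
    show "\<sigma> \<in> extensional (topspace Y)" using \<sigma>(1) by (simp add: Bij_def)
    fix y assume y: "y \<in> topspace Y"
    then have "\<sigma> y \<in> topspace Y" using \<sigma>(1) by (auto simp: Bij_def bij_betw_def)
    then show "\<sigma> y = (\<lambda>y\<in>topspace Y. y) y" using assms \<sigma>(2) y by (simp add: inj_on_def)
  qed auto
  moreover have "homeomorphic_map Y Y (\<lambda>y\<in>topspace Y. y)"
    by (rule homeomorphic_map_eq[of _ _ id]) auto
  ultimately show ?thesis by (auto simp: Deck_def id_Bij)
qed

lemma trivial_group_Deck:
  assumes "inj_on p (topspace Y)"
  shows "trivial_group (Deck Y p)"
proof -
  interpret group "BijGroup (topspace Y)" by (rule group_BijGroup)
  have "Deck Y p = BijGroup (topspace Y)\<lparr>carrier := {\<one>\<^bsub>BijGroup (topspace Y)\<^esub>}\<rparr>"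
    using carrier_Deck_injective[OF assms] by (simp add: Deck_def BijGroup_def)
  then show ?thesis by (simp add: trivial_group_one)
qed

text \<open>The definite description has a unique solution: maps over the base into \<open>Z\<close>
  agree because \<open>q\<close> is injective, and the restriction of any covering map that
  witnesses domination is a solution.\<close>

lemma pointed_covering_map_closed:
  assumes inj: "inj_on q (topspace Z)" and dom: "dominates Y p Z q"
    and y: "y \<in> topspace Y" and z: "z \<in> topspace Z" "q z = p y" and u: "u \<in> topspace Y"
  shows "pointed_covering_map Y p y Z q z u \<in> topspace Z"
proof -
  let ?P = "\<lambda>\<phi>. \<phi> \<in> extensional (topspace Y) \<and> covering_map_over Y p Z q \<phi> \<and> \<phi> y = z"
  obtain \<psi> where \<psi>: "covering_map Y Z \<psi>" "\<And>v. v \<in> topspace Y \<Longrightarrow> q (\<psi> v) = p v"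
    using dom by (auto simp: dominates_def covering_map_over_def)
  have into: "\<phi> v \<in> topspace Z" if "covering_map Y Z \<phi>" "v \<in> topspace Y" for \<phi> v
    using that by (auto simp: covering_map_def)
  have "\<exists>!\<phi>. ?P \<phi>"
  proof (rule ex1I)
    have "\<psi> y = z" using inj into[OF \<psi>(1) y] z \<psi>(2)[OF y] by (simp add: inj_on_def)
    then show "?P (restrict \<psi> (topspace Y))"
      using y \<psi> covering_map_cong[OF \<psi>(1), of "restrict \<psi> (topspace Y)"]
      by (simp add: covering_map_over_def)
    fix \<phi> assume \<phi>: "?P \<phi>"
    show "\<phi> = restrict \<psi> (topspace Y)"
    proof (rule extensionalityI)
      fix v assume v: "v \<in> topspace Y"
      have "q (\<phi> v) = q (\<psi> v)" "\<phi> v \<in> topspace Z" "\<psi> v \<in> topspace Z"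
        using \<phi> v \<psi> into by (auto simp: covering_map_over_def)
      then show "\<phi> v = restrict \<psi> (topspace Y) v" using inj v by (simp add: inj_on_def)
    qed (use \<phi> in auto)
  qed
  from theI'[OF this] have "covering_map Y Z (pointed_covering_map Y p y Z q z)"
    unfolding pointed_covering_map_def covering_map_over_def by blast
  then show ?thesis using into u by blast
qed

lemma trivial_group_Pi_ST:
  assumes inj: "\<And>f. f \<in> weierstrass_polynomials X \<Longrightarrow> inj_on (q f) (topspace (E f))"
    and e: "\<And>f. f \<in> weierstrass_polynomials X \<Longrightarrow> e f \<in> topspace (E f) \<and> q f (e f) = x"
  shows "trivial_group (Pi_ST X E q e)"
proof -
  let ?W = "weierstrass_polynomials X" and ?D = "\<lambda>f. Deck (E f) (q f)"
  let ?P = "product_group ?W ?D"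
  have D: "group (?D f)" "carrier (?D f) = {\<one>\<^bsub>?D f\<^esub>}" if "f \<in> ?W" for f
    using trivial_group_Deck[OF inj[OF that]] by (auto simp: trivial_group_def)
  have one: "\<one>\<^bsub>?D f\<^esub> = (\<lambda>y\<in>topspace (E f). y)" if "f \<in> ?W" for f
    using D(2)[OF that] carrier_Deck_injective[OF inj[OF that]] by simp
  interpret group ?P using D by simp
  have sub: "s = \<one>\<^bsub>?P\<^esub>" if "s \<in> (\<Pi>\<^sub>E f\<in>?W. carrier (?D f))" for s
    using that D(2) by (intro extensionalityI[of _ ?W]) (auto simp: PiE_iff)
  have mem: "\<one>\<^bsub>?P\<^esub> \<in> (\<Pi>\<^sub>E f\<in>?W. carrier (?D f))" using one_closed by simp
  \<comment> \<open>The identity is the only candidate in the description. It qualifies because the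
    pointed map takes values in the carrier of \<open>E g\<close>, outside of which the restricted
    identity is undefined.\<close>
  have res: "deck_res (E f) (q f) (e f) (E g) (q g) (e g) (\<one>\<^bsub>?P\<^esub> f) = \<one>\<^bsub>?P\<^esub> g"
    if f: "f \<in> ?W" and g: "g \<in> ?W" and dom: "dominates (E f) (q f) (E g) (q g)" for f g
  proof -
    let ?\<phi> = "pointed_covering_map (E f) (q f) (e f) (E g) (q g) (e g)"
    have "?\<phi> u \<in> topspace (E g)" if "u \<in> topspace (E f)" for u
      using e[OF f] e[OF g] that by (intro pointed_covering_map_closed[OF inj[OF g] dom]) auto
    then have "(THE \<tau>. \<tau> \<in> carrier (?D g) \<and> (\<forall>u\<in>topspace (E f). \<tau> (?\<phi> u) = ?\<phi> (\<one>\<^bsub>?P\<^esub> f u))) =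
        \<one>\<^bsub>?P\<^esub> g"
      using f g D(2)[OF g] by (intro the_equality) (auto simp: one)
    then show ?thesis by (simp add: deck_res_def)
  qed
  have "Pi_ST X E q e = ?P\<lparr>carrier := {\<one>\<^bsub>?P\<^esub>}\<rparr>"
    unfolding Pi_ST_def using sub mem res by (intro arg_cong[of _ _ "\<lambda>C. ?P\<lparr>carrier := C\<rparr>"]) blast
  then show ?thesis by (simp only: trivial_group_one)
qed

lemma topspace_Pi_ST_topology: "topspace (Pi_ST_topology X E q e) = carrier (Pi_ST X E q e)"
  by (auto simp: Pi_ST_topology_def Pi_ST_def)


section \<open>Continuous cohomology of the trivial group\<close>

text \<open>The whole group is its own only coset. This is applied to the cocycles once they are
  seen to be the coboundaries.\<close>

lemma (in group) trivial_group_Mod_carrier: "trivial_group (G Mod carrier G)"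
proof -
  have "carrier G \<lhd> G"
    by (rule normal_invI) (auto intro: subgroup_self)
  then have "group (G Mod carrier G)" by (rule normal.factorgroup_is_group)
  moreover have "rcosets carrier G = {carrier G}"
    unfolding RCOSETS_def using coset_join2[OF _ subgroup_self] by auto
  ultimately show ?thesis by (simp add: trivial_group_def FactGroup_def)
qed

lemma cochain_group_eq_product:
  assumes "cochains G T A n = (\<Pi>\<^sub>E g\<in>tuples G n. carrier A)"
  shows "cochain_group G T A n = product_group (tuples G n) (\<lambda>_. add_monoid A)"
  using assms by (simp add: cochain_group_def product_group_def)

lemma (in abelian_group) alternating_finsum:
  assumes "a \<in> carrier G"
  shows "(\<Oplus>i\<in>{1..n}. [((-1::int) ^ i)] \<cdot> a) = (if even n then \<zero> else \<ominus> a)"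
proof (induction n)
  case (Suc n)
  have pow: "[((-1::int) ^ i)] \<cdot> a = (if even i then a else \<ominus> a)" for i
    using assms by (simp add: add_pow_int_ge add_pow_int_lt)
  have "{1..Suc n} = insert (Suc n) {1..n}" by auto
  then show ?case using Suc assms by (auto simp: pow finsum_insert l_neg r_neg)
qed simp

text \<open>There is one tuple in each degree, so every cochain group is a copy of \<open>A\<close>.
  The coboundary in degree \<open>m\<close> is an alternating sum of \<open>m + 2\<close> equal
  terms, hence zero for even \<open>m\<close> and the identity for odd \<open>m\<close>. In positive
  degrees one of the two neighbouring differentials is the identity and the other is zero, so the
  complex is exact there.\<close>

lemma trivial_continuous_cohomology:
  assumes triv: "trivial_group G" and T: "topspace T = carrier G"
    and mod: "discrete_module G T A act" and n: "0 < n"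
  shows "trivial_group (continuous_cohomology G T A act n)"
proof -
  interpret G: group G using triv by (simp add: trivial_group_def)
  interpret A: abelian_group A using mod by (simp add: discrete_module_def)
  interpret act: group_action G "carrier A" act using mod by (simp add: discrete_module_def)
  have G1: "carrier G = {\<one>\<^bsub>G\<^esub>}" using triv by (simp add: trivial_group_def)
  define t where "t m = (\<lambda>j\<in>{..<m}. \<one>\<^bsub>G\<^esub>)" for m :: nat
  have tup: "tuples G m = {t m}" for m
    unfolding tuples_def G1 t_def by (simp add: PiE_singleton PiE_eq_singleton)
  have coch: "cochains G T A m = (\<Pi>\<^sub>E g\<in>tuples G m. carrier A)" for m
  proof -
    have "topspace (product_topology (\<lambda>_. T) {..<m}) = {t m}"
      using tup by (simp add: T tuples_def)
    moreover from this have "openin (product_topology (\<lambda>_. T) {..<m}) {t m}"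
      using openin_topspace[of "product_topology (\<lambda>_. T) {..<m}"] by (simp only:)
    \<comment> \<open>On a one-point space every subset is open, so continuity imposes no condition
      on cochains.\<close>
    then have "openin (product_topology (\<lambda>_. T) {..<m}) {g \<in> {t m}. P g}" for P
      by (simp add: Collect_conv_if)
    ultimately show ?thesis
      by (auto simp: cochains_def PiE_def tup continuous_map_def)
  qed
  have one: "\<one>\<^bsub>cochain_group G T A m\<^esub> = (\<lambda>g\<in>tuples G m. \<zero>\<^bsub>A\<^esub>)" for m by (simp add: cochain_group_def)
  have cob: "coboundary G A act m c = (\<lambda>g\<in>tuples G (m + 1). if even m then \<zero>\<^bsub>A\<^esub> else c (t m))"
    if c: "c \<in> cochains G T A m" for m c
  proof -
    have ct: "c (t m) \<in> carrier A" using c by (auto simp: coch tup)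
    have "(\<lambda>j\<in>{..<m}. t (m + 1) (j + 1)) = t m" "(\<lambda>j\<in>{..<m}. t (m + 1) j) = t m"
      "merge_at G m i (t (m + 1)) = t m" for i
      by (auto simp: t_def merge_at_def)
    moreover have "act (t (m + 1) 0) (c (t m)) = c (t m)"
      using fun_cong[OF act.id_eq_one, of "c (t m)"] ct by (simp add: t_def)
    moreover have "[((-1::int) ^ (m + 1))] \<cdot>\<^bsub>A\<^esub> c (t m) = (if even m then \<ominus>\<^bsub>A\<^esub> c (t m) else c (t m))"
      using ct by (simp add: add_pow_int_ge add_pow_int_lt)
    ultimately show ?thesis
      unfolding coboundary_def using ct A.alternating_finsum[OF ct, of m]
      by (intro restrict_ext) (simp add: tup A.r_neg A.l_neg)
  qed
  let ?C = "cochain_group G T A n"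
  have prod: "?C = product_group (tuples G n) (\<lambda>_. add_monoid A)"
    by (rule cochain_group_eq_product[OF coch])
  interpret C: group ?C unfolding prod using A.a_group by simp
  have carrC: "carrier ?C = cochains G T A n" by (simp add: cochain_group_def)
  have one_in: "\<one>\<^bsub>cochain_group G T A m\<^esub> \<in> cochains G T A m" for m
    by (simp add: one coch)
  have nn: "n - 1 + 1 = n" using n by simp
  have "coboundaries G T A act n = cocycles G T A act n \<and>
      group (?C\<lparr>carrier := cocycles G T A act n\<rparr>)"
  proof (cases "even n")
    case True
    then have odd: "odd (n - 1)" using n by simp
    have "cocycles G T A act n = cochains G T A n"
      using True by (auto simp: cocycles_def cob one)
    moreover have "coboundary G A act (n - 1) ` cochains G T A (n - 1) = cochains G T A n"
    proof (intro equalityI subsetI)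
      fix c assume c: "c \<in> cochains G T A n"
      define d where "d = (\<lambda>g\<in>tuples G (n - 1). c (t n))"
      have d: "d \<in> cochains G T A (n - 1)" using c by (auto simp: coch tup d_def)
      have "coboundary G A act (n - 1) d = c"
        unfolding cob[OF d] nn using odd c by (auto simp: d_def tup coch PiE_iff extensional_def)
      then show "c \<in> coboundary G A act (n - 1) ` cochains G T A (n - 1)" using d by blast
    next
      fix c assume "c \<in> coboundary G A act (n - 1) ` cochains G T A (n - 1)"
      then obtain d where d: "d \<in> cochains G T A (n - 1)" "c = coboundary G A act (n - 1) d" by blast
      then show "c \<in> cochains G T A n"
        unfolding d(2) cob[OF d(1)] nn using odd d(1) by (auto simp: coch tup)
    qed
    ultimately show ?thesis
      using n C.is_group by (simp add: coboundaries_def flip: carrC)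
  next
    case False
    have "cocycles G T A act n = {\<one>\<^bsub>?C\<^esub>}"
    proof (intro equalityI subsetI)
      fix c assume "c \<in> cocycles G T A act n"
      then have c: "c \<in> cochains G T A n" "coboundary G A act n c = \<one>\<^bsub>cochain_group G T A (n + 1)\<^esub>"
        by (auto simp: cocycles_def)
      have "coboundary G A act n c (t (n + 1)) = \<zero>\<^bsub>A\<^esub>"
        unfolding c(2) by (simp add: one tup)
      then have "c (t n) = \<zero>\<^bsub>A\<^esub>"
        using False unfolding cob[OF c(1)] by (simp add: tup)
      then have "c = \<one>\<^bsub>?C\<^esub>"
        using c(1) by (auto simp: one coch tup PiE_iff extensional_def)
      then show "c \<in> {\<one>\<^bsub>?C\<^esub>}" by simp
    next
      fix c assume "c \<in> {\<one>\<^bsub>?C\<^esub>}"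
      then show "c \<in> cocycles G T A act n"
        using False one_in[of n] cob[OF one_in[of n]] by (auto simp: cocycles_def one tup)
    qed
    moreover have "coboundary G A act (n - 1) ` cochains G T A (n - 1) = {\<one>\<^bsub>?C\<^esub>}"
      using False n cob[where m = "n - 1"] one_in[of "n - 1"] by (force simp: one nn)
    ultimately show ?thesis
      using n C.trivial_group_one by (simp add: coboundaries_def trivial_group_def)
  qed
  then show ?thesis
    unfolding continuous_cohomology_def using group.trivial_group_Mod_carrier by fastforce
qed


theorem theorem4p7:
  fixes X :: "'a topology"
  assumes "topspace X \<noteq> {}"
    and "Hausdorff_space X"
    and "path_connected_space X"
    and "locally_path_connected_space X"
    and "semilocally_simply_connected_space X"
    and "braid_free_space X"
  shows
    "(\<forall>n f. weierstrass_polynomial X n f \<longrightarrow>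
        (\<exists>(E :: (real \<Rightarrow> 'a) set topology) q. splitting_covering X n f E q) \<and>
        (\<forall>(E :: 'b topology) q. splitting_covering X n f E q \<longrightarrow> isomorphic_over E q X id)) \<and>
     (\<forall>x\<in>topspace X. \<forall>(E :: ('a \<Rightarrow> complex poly) \<Rightarrow> 'b topology) q e.
        pointed_splitting_system X x E q e \<longrightarrow> trivial_group (Pi_ST X E q e)) \<and>
     (\<forall>x\<in>topspace X. \<forall>(E :: ('a \<Rightarrow> complex poly) \<Rightarrow> 'b topology) q e.
        pointed_splitting_system X x E q e \<longrightarrow>
        (\<forall>(A :: ('m, 'z) ring_scheme) act n.
           discrete_module (Pi_ST X E q e) (Pi_ST_topology X E q e) A act \<and> 0 < n \<longrightarrow>
           trivial_group (H_ST X E q e A act n)))"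
proof -
  have splits: "splits_in X id n f" if "weierstrass_polynomial X n f" for n f
    by (rule braid_free_imp_splits[OF that assms(3,4,6,1)])
  have homeo: "homeomorphic_map E X q"
    if "weierstrass_polynomial X n f" "splitting_covering X n f E q" for n f and E :: "'b topology" and q
    by (rule splitting_covering_homeomorphism[OF assms(3) splits[OF that(1)] that(2)])
  have Pi: "trivial_group (Pi_ST X E q e)" if "pointed_splitting_system X x E q e"
    for x and E :: "('a \<Rightarrow> complex poly) \<Rightarrow> 'b topology" and q e
  proof (rule trivial_group_Pi_ST[where x = x])
    fix f assume "f \<in> weierstrass_polynomials X"
    then obtain n where f: "weierstrass_polynomial X n f" by (auto simp: weierstrass_polynomials_def)
    then have *: "splitting_covering X n f (E f) (q f)" "e f \<in> topspace (E f) \<and> q f (e f) = x"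
      using that by (auto simp: pointed_splitting_system_def)
    show "inj_on (q f) (topspace (E f))"
      by (rule homeomorphic_imp_injective_map[OF homeo[OF f *(1)]])
    show "e f \<in> topspace (E f) \<and> q f (e f) = x" by (rule *(2))
  qed
  show ?thesis
  proof (intro conjI allI ballI impI)
    fix n f assume f: "weierstrass_polynomial X n f"
    show "\<exists>(E :: (real \<Rightarrow> 'a) set topology) q. splitting_covering X n f E q"
      by (rule splitting_covering_if_splits[OF assms(3) splits[OF f]])
    fix E :: "'b topology" and q
    assume "splitting_covering X n f E q"
    from homeo[OF f this] show "isomorphic_over E q X id"
      unfolding isomorphic_over_def by auto
  next
    fix x and E :: "('a \<Rightarrow> complex poly) \<Rightarrow> 'b topology" and q e
    assume E: "pointed_splitting_system X x E q e"
    show "trivial_group (Pi_ST X E q e)" by (rule Pi[OF E])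
  next
    fix x and E :: "('a \<Rightarrow> complex poly) \<Rightarrow> 'b topology" and q e
      and A :: "('m, 'z) ring_scheme" and act and n :: nat
    assume E: "pointed_splitting_system X x E q e"
      and A: "discrete_module (Pi_ST X E q e) (Pi_ST_topology X E q e) A act \<and> 0 < n"
    show "trivial_group (H_ST X E q e A act n)"
      unfolding H_ST_def
      by (rule trivial_continuous_cohomology[OF Pi[OF E] topspace_Pi_ST_topology]) (use A in blast)+
  qed
qed

end
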